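(* Let $M$ be a locally compact, connected metric space with a $C^0$ flow. Let $\mathfrak M_{1-6}$ be the set of all $X\in\mathrm{CMin}(M)$ satisfying at least one of the conditions $1.X$ to $6.X$, and let $\mathfrak M_{10}$ be the set of all $X\in\mathrm{CMin}(M)$ satisfying condition $10.X$ (conditions defined in the context). Then: 1) $\mathfrak M_{1-6}$ is the set of isolated compact minimal sets and thus a countable, $d_H$-open subset of $\mathrm{CMin}(M)$. 2) $\mathfrak M_{10}$ is a $d_H$-open and $\mathfrak c$-dense in itself subset of $\mathrm{CMin}(M)$. It is either empty or has the cardinal of the continuum. 3) $\mathfrak M_{1-6}$ is $d_H$-dense in $\mathrm{CMin}(M)\setminus\mathfrak M_{10}$.
   Context: **Flow notions.** A $C^0$ flow is a continuous action $\theta:\mathbb R\times M\to M$ of $(\mathbb R,+)$. A set is invariant if it is a union of orbits $\mathcal O(x)=\{\theta(t,x):t\in\mathbb R\}$; $\mathcal O^{\pm}(x)$ are the half orbits ($t\ge0$, resp. $t\le0$), $\mathcal O^{\pm}(V)=\bigcup_{x\in V}\mathcal O^{\pm}(x)$. $\omega(x),\alpha(x)$ are the usual limit sets (possibly empty); for an orbit $\gamma=\mathcal O(x)$, $\alpha(\gamma)=\alpha(x)$, $\omega(\gamma)=\omega(x)$. A neighbourhood of a set is a set whose interior contains it. $B(X,\epsilon)$ is the open $\epsilon$-neighbourhood of $X$ in $M$. A minimal set is a nonvoid, closed, invariant set containing no proper subset with these properties. $\mathrm{CMin}(X)$ is the set of compact minimal sets contained in $X\subset M$, and $\mathrm{Orb}(X)$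 the set of orbits contained in $X$. A compact minimal set $X$ is isolated if there is a neighbourhood $U$ of $X$ such that $U\setminus X$ contains no minimal set. Countable includes finite and empty. **Stability.** For nonvoid compact invariant $X$: $B^{+}(X)=\{x:\emptyset\ne\omega(x)\subset X\}$, $B^{-}(X)=\{x:\emptyset\ne\alpha(x)\subset X\}$. $X$ is stable (negatively stable) if every neighbourhood $U$ of $X$ contains $\mathcal O^+(V)$ (resp. $\mathcal O^-(V)$) for some neighbourhood $V$ of $X$; an attractor if stable with $B^+(X)$ a neighbourhood of $X$; a repeller if negatively stable with $B^-(X)$ a neighbourhood of $X$; stagnant if there are $x,y\in M\setminus X$ with $\emptyset\ne\alpha(x)\subset X$ and $\emptyset\neq\omega(y)\subset X$. **Hausdorff metric.** $\mathrm{CMin}(M)$ carries the Hausdorff metric $d_H$; the prefix $d_H$- refers to it. A set $\mathfrak C$ of nonvoid compact subsets of $M$ is $\mathfrak c$-dense in itself if for every $\Lambda\in\mathfrak C$ and $\epsilon>0$, $\#\{Y\in\mathfrak C:d_H(\Lambda,Y)<\epsilon\}\ge\mathfrak c$, where $\mathfrak c$ is the cardinal of the continuum. **Orbital structures.** $|Y|_X=\sup\{\mathrm{dist}(y,X):y\in Y\}$. For orbits $\gamma,\zeta$: $\gamma\overset{0}{\succ}\zeta$ means $\zeta\subset\alpha(\gamma)$; $\gamma\overset{1}{\succ}\zeta$ means $\zeta\subset\omega(\gamma)$; $\gamma\succ\zeta$ means $\zeta\subset\alpha(\gamma)\cup\omega(\gamma)$. - Let $\mathcal E$ be the set of nonempty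 finite sequences of 0's and 1's with first digit $0$, and $E_\infty$ the set of infinite such sequences; for $v=0c_1c_2\ldots\in E_\infty$ put $v_0=0$, $v_n=0c_1\ldots c_n$. An $X$-tree is a pair $(\Theta,\psi)$ where, for some compact neighbourhood $U$ of $X$, $\Theta\subset\mathrm{Orb}(U\setminus X)$ and $\psi:\mathcal E\to\Theta$, $a\mapsto\gamma_a$, is a surjection such that for each $b\in\mathcal E$, $c\in\{0,1\}$, $\gamma_b\overset{c}{\succ}\gamma_{bc}$ and $\gamma_{bc}\not\succ\gamma_b$, and for each $v\in E_\infty$, $|\mathrm{cl}\,\gamma_{v_n}|_X\to0$. - An $X$-$\omega$shell is a sequence of orbits $(\gamma_n)_{n\ge1}$ contained in $U\setminus X$ for some compact neighbourhood $U$ of $X$ such that, for all $n\ge1$, $\gamma_n\subset B^-(X)$, $\gamma_n\overset{1}{\succ}\gamma_{n+1}$, $\gamma_{n+1}\not\succ\gamma_n$; and $|\mathrm{cl}\,\gamma_n|_X\to0$. - An $X$-$\alpha$shell is a sequence of orbits that is an $X$-$\omega$shell for the time-reversed flow $(t,x)\mapsto\theta(-t,x)$. **Conditions** on $X\in\mathrm{CMin}(M)$: 1.$X$: $X$ is an attractor. 2.$X$: $X$ is a repeller. 3.$X$: $X$ is an isolated minimal set and stagnant. 4.$X$: $X$ is an isolated minimal set and there is an $X$-$\alpha$shell. 5.$X$: $X$ is an isolated minimal set and there is an $X$-$\omega$shell. 6.$X$: $X$ is an isolated minimal set and there is an $X$-tree. 10.$X$: there is an $\epsilon>0$ such that the compact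 minimal sets contained in $B(X,\epsilon)$ form a $\mathfrak c$-dense in itself subset of $\mathrm{CMin}(M)$. *)

theory Defs
  imports "HOL-Analysis.Analysis"
begin

section \<open>Flows, orbits, limit sets\<close>

locale C0_flow =
  fixes \<theta> :: "real \<Rightarrow> 'a::metric_space \<Rightarrow> 'a"
  assumes flow_cont: "continuous_on UNIV (\<lambda>(t, x). \<theta> t x)"
    and flow_zero: "\<theta> 0 x = x"
    and flow_add: "\<theta> (s + t) x = \<theta> s (\<theta> t x)"

definition reverse_flow :: "(real \<Rightarrow> 'a \<Rightarrow> 'a) \<Rightarrow> real \<Rightarrow> 'a \<Rightarrow> 'a"
  where "reverse_flow \<theta> = (\<lambda>t x. \<theta> (- t) x)"

definition orbit :: "(real \<Rightarrow> 'a \<Rightarrow> 'a) \<Rightarrow> 'a \<Rightarrow> 'a set"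
  where "orbit \<theta> x = {\<theta> t x | t. True}"

definition pos_orbit :: "(real \<Rightarrow> 'a \<Rightarrow> 'a) \<Rightarrow> 'a \<Rightarrow> 'a set"
  where "pos_orbit \<theta> x = {\<theta> t x | t. t \<ge> 0}"

definition neg_orbit :: "(real \<Rightarrow> 'a \<Rightarrow> 'a) \<Rightarrow> 'a \<Rightarrow> 'a set"
  where "neg_orbit \<theta> x = {\<theta> t x | t. t \<le> 0}"

definition Orb :: "(real \<Rightarrow> 'a \<Rightarrow> 'a) \<Rightarrow> 'a set \<Rightarrow> 'a set set"
  where "Orb \<theta> X = {\<gamma> \<in> range (orbit \<theta>). \<gamma> \<subseteq> X}"

definition invariant :: "(real \<Rightarrow> 'a \<Rightarrow> 'a) \<Rightarrow> 'a set \<Rightarrow> bool"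
  where "invariant \<theta> S \<longleftrightarrow> (\<exists>\<O>\<subseteq>range (orbit \<theta>). S = \<Union>\<O>)"

definition omega_lim :: "(real \<Rightarrow> 'a::metric_space \<Rightarrow> 'a) \<Rightarrow> 'a \<Rightarrow> 'a set"
  where "omega_lim \<theta> x =
    {y. \<exists>t :: nat \<Rightarrow> real. filterlim t at_top sequentially \<and> (\<lambda>n. \<theta> (t n) x) \<longlonglongrightarrow> y}"

definition alpha_lim :: "(real \<Rightarrow> 'a::metric_space \<Rightarrow> 'a) \<Rightarrow> 'a \<Rightarrow> 'a set"
  where "alpha_lim \<theta> x =
    {y. \<exists>t :: nat \<Rightarrow> real. filterlim t at_bot sequentially \<and> (\<lambda>n. \<theta> (t n) x) \<longlonglongrightarrow> y}"

text \<open>Limit sets of an orbit. All points of an orbit have the same limit sets, so the unions are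
  over constant families; see \<open>omega_orb_orbit\<close> and \<open>alpha_orb_orbit\<close> below.\<close>

definition omega_orb :: "(real \<Rightarrow> 'a::metric_space \<Rightarrow> 'a) \<Rightarrow> 'a set \<Rightarrow> 'a set"
  where "omega_orb \<theta> \<gamma> = (\<Union>x\<in>\<gamma>. omega_lim \<theta> x)"

definition alpha_orb :: "(real \<Rightarrow> 'a::metric_space \<Rightarrow> 'a) \<Rightarrow> 'a set \<Rightarrow> 'a set"
  where "alpha_orb \<theta> \<gamma> = (\<Union>x\<in>\<gamma>. alpha_lim \<theta> x)"

section \<open>Minimal sets\<close>

definition nbhd :: "'a::topological_space set \<Rightarrow> 'a set \<Rightarrow> bool"
  where "nbhd X U \<longleftrightarrow> X \<subseteq> interior U"

definition set_ball :: "'a::metric_space set \<Rightarrow> real \<Rightarrow> 'a set"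
  where "set_ball X \<epsilon> = (\<Union>x\<in>X. ball x \<epsilon>)"

definition minimal_set :: "(real \<Rightarrow> 'a::metric_space \<Rightarrow> 'a) \<Rightarrow> 'a set \<Rightarrow> bool"
  where "minimal_set \<theta> S \<longleftrightarrow> S \<noteq> {} \<and> closed S \<and> invariant \<theta> S \<and>
    \<not> (\<exists>T. T \<subset> S \<and> T \<noteq> {} \<and> closed T \<and> invariant \<theta> T)"

definition CMin :: "(real \<Rightarrow> 'a::metric_space \<Rightarrow> 'a) \<Rightarrow> 'a set \<Rightarrow> 'a set set"
  where "CMin \<theta> X = {S. S \<subseteq> X \<and> compact S \<and> minimal_set \<theta> S}"

definition isolated_min :: "(real \<Rightarrow> 'a::metric_space \<Rightarrow> 'a) \<Rightarrow> 'a set \<Rightarrow> bool"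
  where "isolated_min \<theta> X \<longleftrightarrow> X \<in> CMin \<theta> UNIV \<and>
    (\<exists>U. nbhd X U \<and> \<not> (\<exists>S. S \<subseteq> U - X \<and> minimal_set \<theta> S))"

section \<open>Stability\<close>

definition Bplus :: "(real \<Rightarrow> 'a::metric_space \<Rightarrow> 'a) \<Rightarrow> 'a set \<Rightarrow> 'a set"
  where "Bplus \<theta> X = {x. omega_lim \<theta> x \<noteq> {} \<and> omega_lim \<theta> x \<subseteq> X}"

definition Bminus :: "(real \<Rightarrow> 'a::metric_space \<Rightarrow> 'a) \<Rightarrow> 'a set \<Rightarrow> 'a set"
  where "Bminus \<theta> X = {x. alpha_lim \<theta> x \<noteq> {} \<and> alpha_lim \<theta> x \<subseteq> X}"

definition stable :: "(real \<Rightarrow> 'a::metric_space \<Rightarrow> 'a) \<Rightarrow> 'a set \<Rightarrow> bool"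
  where "stable \<theta> X \<longleftrightarrow> (\<forall>U. nbhd X U \<longrightarrow> (\<exists>V. nbhd X V \<and> (\<Union>x\<in>V. pos_orbit \<theta> x) \<subseteq> U))"

definition neg_stable :: "(real \<Rightarrow> 'a::metric_space \<Rightarrow> 'a) \<Rightarrow> 'a set \<Rightarrow> bool"
  where "neg_stable \<theta> X \<longleftrightarrow> (\<forall>U. nbhd X U \<longrightarrow> (\<exists>V. nbhd X V \<and> (\<Union>x\<in>V. neg_orbit \<theta> x) \<subseteq> U))"

definition attractor :: "(real \<Rightarrow> 'a::metric_space \<Rightarrow> 'a) \<Rightarrow> 'a set \<Rightarrow> bool"
  where "attractor \<theta> X \<longleftrightarrow> stable \<theta> X \<and> nbhd X (Bplus \<theta> X)"

definition repeller :: "(real \<Rightarrow> 'a::metric_space \<Rightarrow> 'a) \<Rightarrow> 'a set \<Rightarrow> bool"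
  where "repeller \<theta> X \<longleftrightarrow> neg_stable \<theta> X \<and> nbhd X (Bminus \<theta> X)"

definition stagnant :: "(real \<Rightarrow> 'a::metric_space \<Rightarrow> 'a) \<Rightarrow> 'a set \<Rightarrow> bool"
  where "stagnant \<theta> X \<longleftrightarrow>
    (\<exists>x y. x \<notin> X \<and> y \<notin> X \<and> alpha_lim \<theta> x \<noteq> {} \<and> alpha_lim \<theta> x \<subseteq> X \<and>
       omega_lim \<theta> y \<noteq> {} \<and> omega_lim \<theta> y \<subseteq> X)"

section \<open>The Hausdorff metric\<close>

text \<open>\<open>excess X Y\<close> is \<open>|Y|\<^sub>X\<close>. It is meaningful for \<open>X \<noteq> {}\<close> and \<open>Y\<close> nonempty and bounded.\<close>

definition excess :: "'a::metric_space set \<Rightarrow> 'a set \<Rightarrow> real"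
  where "excess X Y = (SUP y\<in>Y. infdist y X)"

text \<open>The Hausdorff metric on nonempty compact sets. The value 0 on other arguments is a dummy: it
  is there because \<^locale>\<open>Metric_space\<close> wants nonnegativity outside the carrier, too.\<close>

definition hausdorff_dist :: "'a::metric_space set \<Rightarrow> 'a set \<Rightarrow> real"
  where "hausdorff_dist X Y =
    (if compact X \<and> X \<noteq> {} \<and> compact Y \<and> Y \<noteq> {} then max (excess X Y) (excess Y X) else 0)"

definition CMin_topology :: "(real \<Rightarrow> 'a::metric_space \<Rightarrow> 'a) \<Rightarrow> 'a set topology"
  where "CMin_topology \<theta> = Metric_space.mtopology (CMin \<theta> UNIV) hausdorff_dist"

text \<open>\<open>UNIV :: real set\<close> represents the cardinal of the continuum.\<close>

definition c_dense_in_itself :: "'a::metric_space set set \<Rightarrow> bool"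
  where "c_dense_in_itself \<C> \<longleftrightarrow>
    (\<forall>\<Lambda>\<in>\<C>. \<forall>\<epsilon>>0. (UNIV :: real set) \<lesssim> {Y \<in> \<C>. hausdorff_dist \<Lambda> Y < \<epsilon>})"

section \<open>Orbital structures\<close>

definition succ_digit :: "(real \<Rightarrow> 'a::metric_space \<Rightarrow> 'a) \<Rightarrow> nat \<Rightarrow> 'a set \<Rightarrow> 'a set \<Rightarrow> bool"
  where "succ_digit \<theta> c \<gamma> \<zeta> \<longleftrightarrow> \<zeta> \<subseteq> (if c = 0 then alpha_orb \<theta> \<gamma> else omega_orb \<theta> \<gamma>)"

definition succ_any :: "(real \<Rightarrow> 'a::metric_space \<Rightarrow> 'a) \<Rightarrow> 'a set \<Rightarrow> 'a set \<Rightarrow> bool"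
  where "succ_any \<theta> \<gamma> \<zeta> \<longleftrightarrow> \<zeta> \<subseteq> alpha_orb \<theta> \<gamma> \<union> omega_orb \<theta> \<gamma>"

definition E_fin :: "nat list set"
  where "E_fin = {a. a \<noteq> [] \<and> set a \<subseteq> {0, 1} \<and> hd a = 0}"

definition E_inf :: "(nat \<Rightarrow> nat) set"
  where "E_inf = {v. range v \<subseteq> {0, 1} \<and> v 0 = 0}"

text \<open>The prefix \<open>v\<^sub>n = 0c\<^sub>1\<dots>c\<^sub>n\<close>, of length \<open>n + 1\<close>.\<close>

definition seq_prefix :: "(nat \<Rightarrow> nat) \<Rightarrow> nat \<Rightarrow> nat list"
  where "seq_prefix v n = map v [0..<Suc n]"

definition is_tree ::
    "(real \<Rightarrow> 'a::metric_space \<Rightarrow> 'a) \<Rightarrow> 'a set \<Rightarrow> 'a set set \<Rightarrow> (nat list \<Rightarrow> 'a set) \<Rightarrow> bool"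
  where "is_tree \<theta> X \<Theta> \<psi> \<longleftrightarrow>
    (\<exists>U. compact U \<and> nbhd X U \<and> \<Theta> \<subseteq> Orb \<theta> (U - X)) \<and>
    \<psi> ` E_fin = \<Theta> \<and>
    (\<forall>b\<in>E_fin. \<forall>c\<in>{0, 1}. succ_digit \<theta> c (\<psi> b) (\<psi> (b @ [c])) \<and> \<not> succ_any \<theta> (\<psi> (b @ [c])) (\<psi> b)) \<and>
    (\<forall>v\<in>E_inf. (\<lambda>n. excess X (closure (\<psi> (seq_prefix v n)))) \<longlonglongrightarrow> 0)"

text \<open>Sequences of orbits are indexed from 1; the value at 0 is irrelevant.\<close>

definition omega_shell ::
    "(real \<Rightarrow> 'a::metric_space \<Rightarrow> 'a) \<Rightarrow> 'a set \<Rightarrow> (nat \<Rightarrow> 'a set) \<Rightarrow> bool"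
  where "omega_shell \<theta> X \<gamma> \<longleftrightarrow>
    (\<exists>U. compact U \<and> nbhd X U \<and> (\<forall>n\<ge>1. \<gamma> n \<in> Orb \<theta> (U - X))) \<and>
    (\<forall>n\<ge>1. \<gamma> n \<subseteq> Bminus \<theta> X \<and> succ_digit \<theta> 1 (\<gamma> n) (\<gamma> (Suc n)) \<and>
       \<not> succ_any \<theta> (\<gamma> (Suc n)) (\<gamma> n)) \<and>
    (\<lambda>n. excess X (closure (\<gamma> n))) \<longlonglongrightarrow> 0"

definition alpha_shell ::
    "(real \<Rightarrow> 'a::metric_space \<Rightarrow> 'a) \<Rightarrow> 'a set \<Rightarrow> (nat \<Rightarrow> 'a set) \<Rightarrow> bool"
  where "alpha_shell \<theta> X \<gamma> \<longleftrightarrow> omega_shell (reverse_flow \<theta>) X \<gamma>"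

section \<open>The conditions\<close>

definition cond1 :: "(real \<Rightarrow> 'a::metric_space \<Rightarrow> 'a) \<Rightarrow> 'a set \<Rightarrow> bool"
  where "cond1 \<theta> X \<longleftrightarrow> attractor \<theta> X"

definition cond2 :: "(real \<Rightarrow> 'a::metric_space \<Rightarrow> 'a) \<Rightarrow> 'a set \<Rightarrow> bool"
  where "cond2 \<theta> X \<longleftrightarrow> repeller \<theta> X"

definition cond3 :: "(real \<Rightarrow> 'a::metric_space \<Rightarrow> 'a) \<Rightarrow> 'a set \<Rightarrow> bool"
  where "cond3 \<theta> X \<longleftrightarrow> isolated_min \<theta> X \<and> stagnant \<theta> X"

definition cond4 :: "(real \<Rightarrow> 'a::metric_space \<Rightarrow> 'a) \<Rightarrow> 'a set \<Rightarrow> bool"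
  where "cond4 \<theta> X \<longleftrightarrow> isolated_min \<theta> X \<and> (\<exists>\<gamma>. alpha_shell \<theta> X \<gamma>)"

definition cond5 :: "(real \<Rightarrow> 'a::metric_space \<Rightarrow> 'a) \<Rightarrow> 'a set \<Rightarrow> bool"
  where "cond5 \<theta> X \<longleftrightarrow> isolated_min \<theta> X \<and> (\<exists>\<gamma>. omega_shell \<theta> X \<gamma>)"

definition cond6 :: "(real \<Rightarrow> 'a::metric_space \<Rightarrow> 'a) \<Rightarrow> 'a set \<Rightarrow> bool"
  where "cond6 \<theta> X \<longleftrightarrow> isolated_min \<theta> X \<and> (\<exists>\<Theta> \<psi>. is_tree \<theta> X \<Theta> \<psi>)"

definition cond10 :: "(real \<Rightarrow> 'a::metric_space \<Rightarrow> 'a) \<Rightarrow> 'a set \<Rightarrow> bool"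
  where "cond10 \<theta> X \<longleftrightarrow> (\<exists>\<epsilon>>0. c_dense_in_itself (CMin \<theta> (set_ball X \<epsilon>)))"

definition M_1_6 :: "(real \<Rightarrow> 'a::metric_space \<Rightarrow> 'a) \<Rightarrow> 'a set set"
  where "M_1_6 \<theta> = {X \<in> CMin \<theta> UNIV.
    cond1 \<theta> X \<or> cond2 \<theta> X \<or> cond3 \<theta> X \<or> cond4 \<theta> X \<or> cond5 \<theta> X \<or> cond6 \<theta> X}"

definition M_10 :: "(real \<Rightarrow> 'a::metric_space \<Rightarrow> 'a) \<Rightarrow> 'a set set"
  where "M_10 \<theta> = {X \<in> CMin \<theta> UNIV. cond10 \<theta> X}"

section \<open>Well-definedness\<close>

context C0_flow
begin

lemma omega_lim_shift_subset: "omega_lim \<theta> (\<theta> s x) \<subseteq> omega_lim \<theta> x"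
proof
  fix y assume "y \<in> omega_lim \<theta> (\<theta> s x)"
  then obtain t :: "nat \<Rightarrow> real" where t: "filterlim t at_top sequentially"
    and y: "(\<lambda>n. \<theta> (t n) (\<theta> s x)) \<longlonglongrightarrow> y"
    unfolding omega_lim_def by blast
  have "filterlim (\<lambda>n. s + t n) at_top sequentially"
    using t by (rule filterlim_tendsto_add_at_top[OF tendsto_const])
  moreover have "(\<lambda>n. \<theta> (s + t n) x) \<longlonglongrightarrow> y"
    using y by (simp add: flow_add[symmetric] add.commute)
  ultimately show "y \<in> omega_lim \<theta> x"
    unfolding omega_lim_def by blast
qed

lemma alpha_lim_shift_subset: "alpha_lim \<theta> (\<theta> s x) \<subseteq> alpha_lim \<theta> x"
proof
  fix y assume "y \<in> alpha_lim \<theta> (\<theta> s x)"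
  then obtain t :: "nat \<Rightarrow> real" where t: "filterlim t at_bot sequentially"
    and y: "(\<lambda>n. \<theta> (t n) (\<theta> s x)) \<longlonglongrightarrow> y"
    unfolding alpha_lim_def by blast
  have "filterlim (\<lambda>n. s + t n) at_bot sequentially"
    using t by (simp add: filterlim_tendsto_add_at_bot_iff[OF tendsto_const])
  moreover have "(\<lambda>n. \<theta> (s + t n) x) \<longlonglongrightarrow> y"
    using y by (simp add: flow_add[symmetric] add.commute)
  ultimately show "y \<in> alpha_lim \<theta> x"
    unfolding alpha_lim_def by blast
qed

lemma omega_orb_orbit: "omega_orb \<theta> (orbit \<theta> x) = omega_lim \<theta> x"
proof -
  have "x \<in> orbit \<theta> x"
    unfolding orbit_def by (simp, metis flow_zero)
  then show ?thesis
    using omega_lim_shift_subset unfolding omega_orb_def by (fastforce simp: orbit_def)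
qed

lemma alpha_orb_orbit: "alpha_orb \<theta> (orbit \<theta> x) = alpha_lim \<theta> x"
proof -
  have "x \<in> orbit \<theta> x"
    unfolding orbit_def by (simp, metis flow_zero)
  then show ?thesis
    using alpha_lim_shift_subset unfolding alpha_orb_def by (fastforce simp: orbit_def)
qed

end

lemma bdd_above_infdist:
  assumes "compact Y"
  shows "bdd_above ((\<lambda>y. infdist y X) ` Y)"
  by (intro bounded_imp_bdd_above compact_imp_bounded compact_continuous_image continuous_intros assms)

lemma infdist_le_excess: "compact Y \<Longrightarrow> y \<in> Y \<Longrightarrow> infdist y X \<le> excess X Y"
  unfolding excess_def by (rule cSUP_upper[OF _ bdd_above_infdist])

lemma excess_nonneg: "compact Y \<Longrightarrow> Y \<noteq> {} \<Longrightarrow> 0 \<le> excess X Y"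
  using infdist_le_excess infdist_nonneg by (metis all_not_in_conv order_trans)

lemma excess_triangle:
  assumes "compact X" "compact Y" "compact Z" "X \<noteq> {}" "Y \<noteq> {}" "Z \<noteq> {}"
  shows "excess X Z \<le> excess X Y + excess Y Z"
  unfolding excess_def[of X Z]
proof (rule cSUP_least[OF \<open>Z \<noteq> {}\<close>])
  fix z assume z: "z \<in> Z"
  have "infdist z X - excess X Y \<le> infdist z Y"
    unfolding infdist_notempty[OF \<open>Y \<noteq> {}\<close>]
  proof (rule cINF_greatest[OF \<open>Y \<noteq> {}\<close>])
    fix y assume "y \<in> Y"
    then show "infdist z X - excess X Y \<le> dist z y"
      using infdist_triangle[of z X y] infdist_le_excess[OF assms(2), of y X] by simp
  qed
  then show "infdist z X \<le> excess X Y + excess Y Z"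
    using infdist_le_excess[OF assms(3) z, of Y] by simp
qed

lemma excess_le_0_imp_subset:
  assumes "compact X" "compact Y" "X \<noteq> {}" "excess X Y \<le> 0"
  shows "Y \<subseteq> X"
proof
  fix y assume "y \<in> Y"
  then have "infdist y X \<le> 0"
    using infdist_le_excess assms by (meson order_trans)
  then show "y \<in> X"
    using assms infdist_nonneg[of y X] in_closed_iff_infdist_zero[of X y] compact_imp_closed by auto
qed

lemma excess_self: "X \<noteq> {} \<Longrightarrow> excess X X = 0"
  unfolding excess_def by simp

lemma Metric_space_hausdorff_dist:
  assumes "\<And>X. X \<in> \<C> \<Longrightarrow> compact X \<and> X \<noteq> {}"
  shows "Metric_space \<C> hausdorff_dist"
proof
  fix X Y :: "'a set"
  show "0 \<le> hausdorff_dist X Y"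
    unfolding hausdorff_dist_def by (simp add: excess_nonneg le_max_iff_disj)
  show "hausdorff_dist X Y = hausdorff_dist Y X"
    unfolding hausdorff_dist_def by (simp add: max.commute conj_ac)
next
  fix X Y assume XY: "X \<in> \<C>" "Y \<in> \<C>"
  then have *: "compact X" "X \<noteq> {}" "compact Y" "Y \<noteq> {}"
    using assms by auto
  show "hausdorff_dist X Y = 0 \<longleftrightarrow> X = Y"
  proof
    assume "hausdorff_dist X Y = 0"
    then have "excess X Y \<le> 0" "excess Y X \<le> 0"
      using * unfolding hausdorff_dist_def
      by (auto simp: max_def split: if_splits)
    then show "X = Y"
      using excess_le_0_imp_subset * by (metis subset_antisym)
  next
    assume "X = Y"
    then show "hausdorff_dist X Y = 0"
      unfolding hausdorff_dist_def by (simp add: excess_self)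
  qed
next
  fix X Y Z assume XYZ: "X \<in> \<C>" "Y \<in> \<C>" "Z \<in> \<C>"
  then have *: "compact X" "X \<noteq> {}" "compact Y" "Y \<noteq> {}" "compact Z" "Z \<noteq> {}"
    using assms by auto
  show "hausdorff_dist X Z \<le> hausdorff_dist X Y + hausdorff_dist Y Z"
    using excess_triangle[of X Y Z] excess_triangle[of Z Y X] *
    unfolding hausdorff_dist_def by (auto simp: max_def)
qed

lemma Metric_space_CMin: "Metric_space (CMin \<theta> UNIV) hausdorff_dist"
  by (rule Metric_space_hausdorff_dist) (auto simp: CMin_def minimal_set_def)

end

theory Submission
  imports Defs
begin

text \<open>
The whole argument happens near compact minimal sets, in compact collars
\<open>{y. infdist y X \<le> d}\<close>, which exist by local compactness. Three facts carry it.

\<^emph>\<open>Nearness is one-sided.\<close> An orbit in a minimal set \<open>X\<close> is dense in \<open>X\<close>, and finite pieces of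
orbits depend continuously on the starting point. So a minimal set that lies close enough to \<open>X\<close>
comes close to every point of \<open>X\<close>, and the sets \<open>CMin \<theta> (set_ball X e)\<close> form a base of
neighbourhoods of \<open>X\<close> for the Hausdorff metric (\<open>openin_CMin_topology_iff\<close>). In particular, the
isolated minimal sets are the isolated points of \<open>CMin \<theta> UNIV\<close>. A connected, locally compact metric
space is separable, so there are at most countably many of them, and at most continuum many
compact minimal sets in all.

\<^emph>\<open>Without isolated points there is a Cantor scheme.\<close> If an open set contains no isolated compact
minimal set, every compact set whose interior contains a minimal set splits into two disjoint compact
sets of the same kind. Along each branch of the resulting binary tree, the points whose whole orbit
stays in every set of the branch form a nonempty compact invariant set, which contains a minimal
set. Distinct branches give disjoint minimal sets, so there are continuum many
(\<open>continuum_of_minimal_sets\<close>). Hence a compact minimal set outside the closure of the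
isolated ones belongs to \<open>M_10 \<theta>\<close>.

\<^emph>\<open>Isolated minimal sets are attractors, repellers, stagnant, or have shells or trees.\<close> Let \<open>X\<close> be
isolated, so that every nonempty compact invariant set in a small collar contains \<open>X\<close>. If \<open>X\<close> is
stable, it is an attractor; in reversed time, a repeller. Otherwise suppose that \<open>X\<close> is not stagnant,
say that no point outside \<open>X\<close> has a nonempty \<open>\<omega>\<close>-limit set in \<open>X\<close>. The basic device is to follow
points to the moment of their last entry into a collar, and to pass to a limit: the limit point lies
at the edge of the collar, and its positive half orbit stays inside. Its \<open>\<omega>\<close>-limit set lies in
the collar and properly contains \<open>X\<close>. So an orbit in the collar, but outside \<open>X\<close>, has in its
\<open>\<omega>\<close>-limit set orbits outside \<open>X\<close> that stay twice as close to \<open>X\<close> as a given point of the first orbit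
(\<open>shrinking_omega_step\<close>). If some compact invariant set \<open>L\<close> in the collar that is not contained in \<open>X\<close> has no orbit outside \<open>X\<close> whose \<open>\<alpha>\<close>- or \<open>\<omega>\<close>-limit set lies in \<open>X\<close>,
such a step is possible in both time directions, and its iteration in \<open>L\<close> gives an \<open>X\<close>-tree. If there
is no such \<open>L\<close>, each step can be made to end at an orbit whose \<open>\<alpha>\<close>-limit set lies in \<open>X\<close>, and the
iteration gives an \<open>X\<close>-\<open>\<omega>\<close>shell. Halving the distance makes the orbits shrink to \<open>X\<close> and keeps each
one out of the limit sets of its successors.
\<close>

section \<open>Collars of compact sets and separability\<close>

lemma infdist_lessE:
  assumes "infdist y X < e" "X \<noteq> {}"
  obtains x where "x \<in> X" "dist y x < e"
  using assms by (auto simp: infdist_notempty cINF_less_iff)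

lemma set_ball_eq_infdist:
  assumes "X \<noteq> {}"
  shows "set_ball X e = {y. infdist y X < e}"
proof -
  have "infdist y X < e \<longleftrightarrow> (\<exists>x\<in>X. dist x y < e)" for y
    using infdist_lessE[OF _ assms] infdist_le by (metis dist_commute le_less_trans)
  then show ?thesis
    by (auto simp: set_ball_def)
qed

lemma set_ball_mono: "d \<le> e \<Longrightarrow> set_ball X d \<subseteq> set_ball X e"
  by (force simp: set_ball_def)

lemma open_set_ball: "open (set_ball X e)"
  by (auto simp: set_ball_def)

lemma subset_set_ball: "e > 0 \<Longrightarrow> X \<subseteq> set_ball X e"
  by (force simp: set_ball_def)

lemma closed_collar: "closed {y. infdist y X \<le> d}"
  by (intro closed_Collect_le continuous_intros)

lemma collar_subset_open:
  fixes X :: "'a::metric_space set"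
  assumes "compact X" "X \<noteq> {}" "open B" "X \<subseteq> B"
  obtains d where "d > 0" "{y. infdist y X \<le> d} \<subseteq> B"
proof (cases "B = UNIV")
  case True
  then show ?thesis
    using that[of 1] by simp
next
  case False
  have "continuous_on X (\<lambda>x. infdist x (- B))"
    by (intro continuous_intros)
  then obtain p where p: "p \<in> X" "\<And>x. x \<in> X \<Longrightarrow> infdist p (- B) \<le> infdist x (- B)"
    using continuous_attains_inf[OF assms(1,2)] by blast
  have pos: "infdist p (- B) > 0"
    using infdist_pos_not_in_closed[of "- B" p] False assms p by auto
  have "y \<in> B" if "infdist y X \<le> infdist p (- B) / 2" for y
  proof (rule ccontr)
    assume y: "y \<notin> B"
    have "infdist y X < infdist p (- B)"
      using that pos by linarith
    then obtain x where "x \<in> X" "dist y x < infdist p (- B)"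
      using infdist_lessE assms(2) by metis
    moreover have "infdist x (- B) \<le> dist x y"
      using y by (intro infdist_le) auto
    ultimately show False
      using p(2)[of x] by (simp add: dist_commute)
  qed
  then show ?thesis
    using that[of "infdist p (- B) / 2"] pos by auto
qed

lemma compact_collar:
  fixes X :: "'a::metric_space set"
  assumes lc: "locally compact (UNIV :: 'a set)"
    and X: "compact X" "X \<noteq> {}" "open B" "X \<subseteq> B"
  obtains d where "d > 0" "compact {y. infdist y X \<le> d}" "{y. infdist y X \<le> d} \<subseteq> B"
proof -
  obtain u v where uv: "\<And>x. x \<in> u x \<and> u x \<subseteq> v x \<and> open (u x) \<and> compact (v x :: 'a set)"
    using locally_compactE[OF lc] by (metis UNIV_I open_openin subtopology_UNIV)
  obtain F where F: "F \<subseteq> X" "finite F" "X \<subseteq> (\<Union>x\<in>F. u x)"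
    by (rule compactE_image[OF X(1), of X u]) (use uv in auto)
  have op: "open (B \<inter> (\<Union>x\<in>F. u x))"
    using uv by (intro open_Int X open_UN) blast
  have sub: "X \<subseteq> B \<inter> (\<Union>x\<in>F. u x)"
    using X F by blast
  obtain d where d: "d > 0" "{y. infdist y X \<le> d} \<subseteq> B \<inter> (\<Union>x\<in>F. u x)"
    by (rule collar_subset_open[OF X(1,2) op sub])
  have "compact (\<Union>x\<in>F. v x)"
    using F uv by blast
  moreover have "{y. infdist y X \<le> d} \<subseteq> (\<Union>x\<in>F. v x)"
    using d(2) UN_mono[of F F u v] uv by (meson Int_subset_iff order_refl subset_trans)
  ultimately have "compact {y. infdist y X \<le> d}"
    using closed_collar by (metis compact_Int_closed inf.absorb_iff2)
  then show ?thesis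
    using that d by blast
qed

lemma compact_smaller_collar:
  fixes X :: "'a::metric_space set"
  assumes "compact {y. infdist y X \<le> d}" "c \<le> d"
  shows "compact {y. infdist y X \<le> c}"
proof -
  have "{y. infdist y X \<le> c} = {y. infdist y X \<le> d} \<inter> {y. infdist y X \<le> c}"
    using assms(2) by auto
  then show ?thesis
    using compact_Int_closed[OF assms(1) closed_collar] by metis
qed

lemma nbhd_collar:
  assumes "d > 0"
  shows "nbhd X {y. infdist y X \<le> d}"
proof -
  have "open {y. infdist y X < d}"
    by (intro open_Collect_less continuous_intros)
  then have "{y. infdist y X < d} \<subseteq> interior {y. infdist y X \<le> d}"
    by (intro interior_maximal) auto
  then show ?thesis
    using assms unfolding nbhd_def by force
qed

text \<open>The points \<open>y n\<close> need not lie in a compact set, but their nearest points in \<open>X\<close> do, and these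
converge along the same subsequences. This gives tube lemmas around \<open>X\<close> in any metric space.\<close>

lemma convergent_subsequence_near_compact:
  fixes y :: "nat \<Rightarrow> 'a::metric_space" and x :: "nat \<Rightarrow> 'b::metric_space"
  assumes X: "compact X" "X \<noteq> {}" and y: "\<And>n. infdist (y n) X < inverse (Suc n)"
    and K: "compact K" and x: "\<And>n. x n \<in> K"
  obtains l m and r :: "nat \<Rightarrow> nat" where "l \<in> X" "m \<in> K" "strict_mono r"
    "(\<lambda>n. y (r n)) \<longlonglongrightarrow> l" "(\<lambda>n. x (r n)) \<longlonglongrightarrow> m"
proof -
  have "\<exists>p\<in>X. dist (y n) p < inverse (Suc n)" for n
    using infdist_lessE[OF y[of n] X(2)] by blast
  then obtain p where p: "\<And>n. p n \<in> X" "\<And>n. dist (y n) (p n) < inverse (Suc n)"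
    by metis
  have "seq_compact (X \<times> K)"
    using X(1) K by (simp add: compact_Times compact_imp_seq_compact)
  moreover have "\<forall>n. (p n, x n) \<in> X \<times> K"
    using p x by simp
  ultimately obtain l and r :: "nat \<Rightarrow> nat"
    where l: "l \<in> X \<times> K" and r: "strict_mono r" "((\<lambda>n. (p n, x n)) \<circ> r) \<longlonglongrightarrow> l"
    by (rule seq_compactE)
  have pl: "(\<lambda>n. p (r n)) \<longlonglongrightarrow> fst l" and xl: "(\<lambda>n. x (r n)) \<longlonglongrightarrow> snd l"
    using tendsto_fst[OF r(2)] tendsto_snd[OF r(2)] by (simp_all add: o_def)
  have "(\<lambda>n. inverse (real (Suc n))) \<longlonglongrightarrow> 0"
    by (rule LIMSEQ_inverse_real_of_nat)
  from LIMSEQ_subseq_LIMSEQ[OF this r(1)] have "(\<lambda>n. inverse (real (Suc (r n)))) \<longlonglongrightarrow> 0"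
    by (simp add: o_def)
  then have "(\<lambda>n. dist (y (r n)) (p (r n))) \<longlonglongrightarrow> 0"
    by (rule Lim_null_comparison[rotated]) (use p(2) in \<open>auto intro!: always_eventually less_imp_le\<close>)
  then have "(\<lambda>n. dist (y (r n)) (p (r n)) + dist (p (r n)) (fst l)) \<longlonglongrightarrow> 0 + 0"
    using pl[THEN iffD1[OF tendsto_dist_iff]] by (rule tendsto_add)
  then have "(\<lambda>n. dist (y (r n)) (fst l)) \<longlonglongrightarrow> 0"
    by (intro Lim_null_comparison[of "\<lambda>n. dist (y (r n)) (fst l)"])
      (auto intro!: always_eventually dist_triangle)
  then have yl: "(\<lambda>n. y (r n)) \<longlonglongrightarrow> fst l"
    by (rule iffD2[OF tendsto_dist_iff])
  show ?thesis
    by (rule that[OF _ _ r(1) yl xl]) (use l in \<open>simp_all add: mem_Times_iff\<close>)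
qed

lemma compact_countable_dense:
  fixes K :: "'a::metric_space set"
  assumes "compact K"
  obtains D where "countable D" "K \<subseteq> closure D"
proof -
  have "\<exists>k. finite k \<and> K \<subseteq> (\<Union>x\<in>k. ball x (1 / Suc n))" for n
    using assms unfolding compact_eq_totally_bounded by (metis of_nat_0_less_iff zero_less_Suc zero_less_divide_1_iff)
  then obtain k where k: "\<And>n. finite (k n)" "\<And>n. K \<subseteq> (\<Union>x\<in>k n. ball x (1 / Suc n))"
    by metis
  have "K \<subseteq> closure (\<Union>n. k n)"
  proof
    fix x assume "x \<in> K"
    have "\<exists>y\<in>\<Union>n. k n. dist y x < e" if "e > 0" for e
    proof -
      from \<open>0 < e\<close> obtain n where "1 / Suc n < e"
        by (rule nat_approx_posE)
      moreover obtain y where "y \<in> k n" "dist y x < 1 / Suc n"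
        using k(2)[of n] \<open>x \<in> K\<close> by auto
      ultimately show ?thesis
        by force
    qed
    then show "x \<in> closure (\<Union>n. k n)"
      by (simp add: closure_approachable)
  qed
  moreover have "countable (\<Union>n. k n)"
    using k(1) by (simp add: countable_finite)
  ultimately show ?thesis
    using that by blast
qed

text \<open>Starting from a point, pass repeatedly from a countable set to a countable dense subset of the
union of all compact balls of rational radius about its points. The closure of the union of these sets
is open: near a point of it, a small compact ball about an approximating point has been included. By
connectedness it is the whole space.\<close>

lemma connected_locally_compact_separable:
  fixes a :: "'a::metric_space"
  assumes lc: "locally compact (UNIV :: 'a set)"
    and conn: "connected (UNIV :: 'a set)"
  obtains D :: "'a set" where "countable D" "closure D = UNIV"
proof -
  define C where "C A = {K. \<exists>a\<in>A. \<exists>q::rat. K = cball a (of_rat q) \<and> compact K}" for A :: "'a set"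
  have "\<exists>D. countable D \<and> \<Union>(C A) \<subseteq> closure D" if "countable A" for A
  proof -
    have "C A \<subseteq> (\<lambda>(a, q). cball a (of_rat q)) ` (A \<times> UNIV)"
      by (auto simp: C_def image_iff)
    then have "countable (C A)"
      by (rule countable_subset) (use that in auto)
    moreover have "\<forall>K\<in>C A. \<exists>D. countable D \<and> K \<subseteq> closure D"
      unfolding C_def using compact_countable_dense by blast
    then obtain D where D: "\<And>K. K \<in> C A \<Longrightarrow> countable (D K) \<and> K \<subseteq> closure (D K)"
      by metis
    ultimately have "countable (\<Union>(D ` C A))"
      by auto
    moreover have "\<Union>(C A) \<subseteq> closure (\<Union>(D ` C A))"
      using D closure_mono[of "D _" "\<Union>(D ` C A)"] by blast
    ultimately show ?thesis
      by blast
  qed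
  then obtain G where G: "\<And>A. countable A \<Longrightarrow> countable (G A) \<and> \<Union>(C A) \<subseteq> closure (G A)"
    by metis
  define E where "E n = (G ^^ n) {a}" for n
  have E: "countable (E n)" for n
    by (induction n) (auto simp: E_def G)
  have step: "\<Union>(C (E n)) \<subseteq> closure (\<Union>n. E n)" for n
  proof -
    have "E (Suc n) \<subseteq> (\<Union>n. E n)"
      by blast
    then show ?thesis
      using G[OF E[of n]] closure_mono[of "E (Suc n)" "\<Union>n. E n"] by (auto simp: E_def)
  qed
  have "open (closure (\<Union>n. E n))"
    unfolding open_dist
  proof
    fix y assume y: "y \<in> closure (\<Union>n. E n)"
    obtain d where d: "d > 0" "compact {z. infdist z {y} \<le> d}"
      using compact_collar[OF lc, of "{y}" UNIV] by auto
    obtain q :: rat where q: "0 < real_of_rat q" "real_of_rat q < d / 2"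
      using of_rat_dense[of 0 "d / 2"] d by auto
    obtain n x where x: "x \<in> E n" "dist x y < of_rat q / 2"
      using y q unfolding closure_approachable by (meson UN_E half_gt_zero)
    have "cball x (of_rat q) \<subseteq> {z. infdist z {y} \<le> d}"
    proof
      fix z assume "z \<in> cball x (of_rat q)"
      then show "z \<in> {z. infdist z {y} \<le> d}"
        using x(2) q(2) d(1) dist_triangle[of z y x] by (simp add: dist_commute)
    qed
    then have "compact (cball x (of_rat q))"
      using d(2) by (metis closed_cball compact_Int_closed inf.absorb_iff2)
    then have "cball x (of_rat q) \<subseteq> closure (\<Union>n. E n)"
      using step[of n] x unfolding C_def by blast
    moreover have "z \<in> cball x (of_rat q)" if "dist z y < of_rat q / 2" for z
      using that x dist_triangle[of x z y] by (simp add: dist_commute)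
    ultimately show "\<exists>e>0. \<forall>z. dist z y < e \<longrightarrow> z \<in> closure (\<Union>n. E n)"
      using q by (metis half_gt_zero subsetD)
  qed
  moreover have "a \<in> E 0"
    by (simp add: E_def)
  then have "a \<in> closure (\<Union>n. E n)"
    using closure_subset[of "\<Union>n. E n"] by blast
  ultimately have "closure (\<Union>n. E n) = UNIV"
    using conn closed_closure[of "\<Union>n. E n"] by (auto simp: connected_clopen)
  then show ?thesis
    using that E by (metis countable_UN countableI_type)
qed

lemma lepoll_superset: "A \<lesssim> B \<Longrightarrow> B \<subseteq> C \<Longrightarrow> A \<lesssim> C"
  by (erule lepoll_trans) (rule subset_imp_lepoll)

lemma dense_rat_ball:
  fixes D :: "'a::metric_space set"
  assumes "closure D = UNIV" "open B" "x \<in> B"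
  obtains d and q :: rat where "d \<in> D" "x \<in> ball d (of_rat q)" "ball d (of_rat q) \<subseteq> B"
proof -
  obtain e where e: "e > 0" "ball x e \<subseteq> B"
    using assms(2,3) by (rule openE)
  obtain q :: rat where q: "0 < real_of_rat q" "real_of_rat q < e / 2"
    using of_rat_dense[of 0 "e / 2"] e by auto
  obtain d where d: "d \<in> D" "dist d x < of_rat q"
    using assms(1) q(1) closure_approachable by (metis UNIV_I)
  have "ball d (of_rat q) \<subseteq> ball x e"
  proof
    fix z assume "z \<in> ball d (of_rat q)"
    then show "z \<in> ball x e"
      using d q dist_triangle[of x z d] by (auto simp: dist_commute)
  qed
  then show ?thesis
    using that d e by (metis dual_order.trans mem_ball)
qed

text \<open>A closed set is determined by the rational balls with centre in \<open>D\<close> that miss it.\<close>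

lemma closed_sets_lepoll_reals:
  fixes D :: "'a::metric_space set"
  assumes "countable D" "closure D = UNIV"
  shows "{A :: 'a set. closed A} \<lesssim> (UNIV :: real set)"
proof -
  define P where "P = D \<times> (UNIV :: rat set)"
  define f where "f A = {(d, q) \<in> P. ball d (of_rat q) \<inter> A = {}}" for A :: "'a set"
  have sub: "A \<subseteq> B" if fBA: "f B \<subseteq> f A" and B: "closed B" for A B
  proof (rule ccontr)
    assume "\<not> A \<subseteq> B"
    then obtain x where x: "x \<in> A" "x \<in> - B"
      by auto
    obtain d q where dq: "d \<in> D" "x \<in> ball d (of_rat q)" "ball d (of_rat q) \<subseteq> - B"
      by (rule dense_rat_ball[OF assms(2) open_Compl[OF B] x(2)])
    then have "(d, q) \<in> f B" "(d, q) \<notin> f A"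
      using x unfolding f_def P_def by auto
    then show False
      using fBA by blast
  qed
  have "countable P"
    unfolding P_def using assms(1) by auto
  then obtain g :: "'a \<times> rat \<Rightarrow> nat" where g: "inj_on g P"
    unfolding countable_def by blast
  have "inj_on (\<lambda>A. g ` f A) {A. closed A}"
  proof (rule inj_onI)
    fix A B assume "A \<in> {A. closed A}" "B \<in> {A. closed A}" "g ` f A = g ` f B"
    moreover have "f A \<subseteq> P" "f B \<subseteq> P"
      by (auto simp: f_def)
    ultimately show "A = B"
      using sub[of A B] sub[of B A] inj_on_image_eq_iff[OF g] by auto
  qed
  then have "{A :: 'a set. closed A} \<lesssim> (UNIV :: nat set set)"
    unfolding lepoll_def by blast
  then show ?thesis
    using lepoll_trans2 nat_sets_eqpoll_reals by blast
qed

section \<open>Invariant sets and limit sets\<close>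

context C0_flow
begin

lemma flow_tendsto:
  assumes "(t \<longlongrightarrow> s) F" "(x \<longlongrightarrow> y) F"
  shows "((\<lambda>n. \<theta> (t n) (x n)) \<longlongrightarrow> \<theta> s y) F"
proof -
  have "isCont (\<lambda>(t, x). \<theta> t x) (s, y)"
    using flow_cont by (simp add: continuous_on_eq_continuous_at)
  from isCont_tendsto_compose[OF this tendsto_Pair[OF assms]] show ?thesis
    by simp
qed

lemma continuous_on_flow_point: "continuous_on S (\<lambda>t. \<theta> t x)"
  unfolding continuous_on_def by (intro ballI flow_tendsto tendsto_intros)

lemma flow_minus [simp]: "\<theta> (- t) (\<theta> t x) = x" "\<theta> t (\<theta> (- t) x) = x"
  using flow_add[of "- t" t x] flow_add[of t "- t" x] flow_zero by auto

lemma mem_orbit: "x \<in> orbit \<theta> x"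
  unfolding orbit_def using flow_zero[of x] by (metis (mono_tags, lifting) mem_Collect_eq)

lemma invariant_iff: "invariant \<theta> S \<longleftrightarrow> (\<forall>x\<in>S. \<forall>t. \<theta> t x \<in> S)"
proof
  assume "invariant \<theta> S"
  then obtain A where A: "A \<subseteq> range (orbit \<theta>)" "S = \<Union>A"
    unfolding invariant_def by blast
  show "\<forall>x\<in>S. \<forall>t. \<theta> t x \<in> S"
  proof (intro ballI allI)
    fix x t assume "x \<in> S"
    then obtain y where "orbit \<theta> y \<in> A" "x \<in> orbit \<theta> y"
      using A by auto
    then have "\<theta> t x \<in> orbit \<theta> y"
      unfolding orbit_def by (auto simp flip: flow_add)
    then show "\<theta> t x \<in> S"
      using A \<open>orbit \<theta> y \<in> A\<close> by blast
  qed
next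
  assume *: "\<forall>x\<in>S. \<forall>t. \<theta> t x \<in> S"
  have "S = \<Union>(orbit \<theta> ` S)"
  proof
    show "S \<subseteq> \<Union>(orbit \<theta> ` S)"
      using mem_orbit by blast
    show "\<Union>(orbit \<theta> ` S) \<subseteq> S"
      using * by (auto simp: orbit_def)
  qed
  then show "invariant \<theta> S"
    unfolding invariant_def by (intro exI[of _ "orbit \<theta> ` S"]) auto
qed

lemma invariantD: "invariant \<theta> S \<Longrightarrow> x \<in> S \<Longrightarrow> \<theta> t x \<in> S"
  by (simp add: invariant_iff)

lemma orbit_subset: "invariant \<theta> S \<Longrightarrow> x \<in> S \<Longrightarrow> orbit \<theta> x \<subseteq> S"
  by (auto simp: orbit_def invariantD)

lemma invariant_orbit: "invariant \<theta> (orbit \<theta> x)"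
  unfolding invariant_def by (intro exI[of _ "{orbit \<theta> x}"]) auto

lemma invariant_Int: "invariant \<theta> S \<Longrightarrow> invariant \<theta> T \<Longrightarrow> invariant \<theta> (S \<inter> T)"
  by (auto simp: invariant_iff)

lemma invariant_closure:
  assumes "invariant \<theta> S"
  shows "invariant \<theta> (closure S)"
  unfolding invariant_iff
proof (intro ballI allI)
  fix x t assume "x \<in> closure S"
  then obtain u where u: "\<And>n. u n \<in> S" "u \<longlonglongrightarrow> x"
    unfolding closure_sequential by blast
  have "(\<lambda>n. \<theta> t (u n)) \<longlonglongrightarrow> \<theta> t x"
    using u by (intro flow_tendsto tendsto_intros)
  then show "\<theta> t x \<in> closure S"
    unfolding closure_sequential using u(1) invariantD[OF assms]
    by (intro exI[of _ "\<lambda>n. \<theta> t (u n)"]) auto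
qed

text \<open>The description without sequences makes closedness and the comparison with closed sets
immediate.\<close>

lemma omega_lim_iff: "y \<in> omega_lim \<theta> x \<longleftrightarrow> (\<forall>T. \<forall>e>0. \<exists>t\<ge>T. dist (\<theta> t x) y < e)"
proof
  assume "y \<in> omega_lim \<theta> x"
  then obtain t :: "nat \<Rightarrow> real" where t: "filterlim t at_top sequentially" "(\<lambda>n. \<theta> (t n) x) \<longlonglongrightarrow> y"
    unfolding omega_lim_def by blast
  show "\<forall>T. \<forall>e>0. \<exists>t\<ge>T. dist (\<theta> t x) y < e"
  proof (intro allI impI)
    fix T and e :: real assume "e > 0"
    then have "\<forall>\<^sub>F n in sequentially. t n \<ge> T \<and> dist (\<theta> (t n) x) y < e"
      using t by (intro eventually_conj) (auto simp: filterlim_at_top dest: tendstoD)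
    then show "\<exists>t\<ge>T. dist (\<theta> t x) y < e"
      using eventually_happens'[OF sequentially_bot] by blast
  qed
next
  assume *: "\<forall>T. \<forall>e>0. \<exists>t\<ge>T. dist (\<theta> t x) y < e"
  have "\<exists>t\<ge>real n. dist (\<theta> t x) y < inverse (Suc n)" for n
    using *[rule_format, of "inverse (Suc n)" "real n"] by simp
  then obtain t :: "nat \<Rightarrow> real" where t: "\<And>n. t n \<ge> real n" "\<And>n. dist (\<theta> (t n) x) y < inverse (Suc n)"
    by metis
  have "filterlim t at_top sequentially"
    by (rule filterlim_at_top_mono[OF filterlim_real_sequentially]) (use t in auto)
  moreover have "(\<lambda>n. \<theta> (t n) x) \<longlonglongrightarrow> y"
  proof (rule metric_LIMSEQ_I)
    fix r :: real assume "r > 0"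
    then obtain N where N: "inverse (Suc N) < r"
      using reals_Archimedean by blast
    have "dist (\<theta> (t n) x) y < r" if "n \<ge> N" for n
    proof -
      have "inverse (real (Suc n)) \<le> inverse (Suc N)"
        using that by (intro le_imp_inverse_le) auto
      then show ?thesis
        using t(2)[of n] N by linarith
    qed
    then show "\<exists>no. \<forall>n\<ge>no. dist (\<theta> (t n) x) y < r"
      by blast
  qed
  ultimately show "y \<in> omega_lim \<theta> x"
    unfolding omega_lim_def by blast
qed

lemma closed_omega_lim: "closed (omega_lim \<theta> x)"
  unfolding closed_sequential_limits
proof safe
  fix u y assume u: "\<forall>n. u n \<in> omega_lim \<theta> x" "u \<longlonglongrightarrow> y"
  show "y \<in> omega_lim \<theta> x"
    unfolding omega_lim_iff
  proof (intro allI impI)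
    fix T and e :: real assume "e > 0"
    then obtain n where n: "dist (u n) y < e / 2"
      using metric_LIMSEQ_D[OF u(2), of "e / 2"] by auto
    obtain t where "t \<ge> T" "dist (\<theta> t x) (u n) < e / 2"
      using u(1) \<open>e > 0\<close> omega_lim_iff by (meson half_gt_zero)
    then show "\<exists>t\<ge>T. dist (\<theta> t x) y < e"
      using n dist_triangle_half_r[of "u n" "\<theta> t x" e y] by (auto simp: dist_commute)
  qed
qed

lemma invariant_omega_lim: "invariant \<theta> (omega_lim \<theta> x)"
  unfolding invariant_iff
proof (intro ballI allI)
  fix y s assume "y \<in> omega_lim \<theta> x"
  then obtain t :: "nat \<Rightarrow> real" where t: "filterlim t at_top sequentially" "(\<lambda>n. \<theta> (t n) x) \<longlonglongrightarrow> y"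
    unfolding omega_lim_def by blast
  have "(\<lambda>n. \<theta> (s + t n) x) \<longlonglongrightarrow> \<theta> s y"
    unfolding flow_add by (intro flow_tendsto tendsto_intros t)
  moreover have "filterlim (\<lambda>n. s + t n) at_top sequentially"
    using t(1) by (rule filterlim_tendsto_add_at_top[OF tendsto_const])
  ultimately show "\<theta> s y \<in> omega_lim \<theta> x"
    unfolding omega_lim_def by blast
qed

lemma omega_lim_subset_closed:
  assumes "closed K" "\<And>t. t \<ge> T \<Longrightarrow> \<theta> t x \<in> K"
  shows "omega_lim \<theta> x \<subseteq> K"
proof
  fix y assume "y \<in> omega_lim \<theta> x"
  then have "y \<in> closure K"
    unfolding omega_lim_iff closure_approachable using assms(2) by blast
  then show "y \<in> K"
    using assms(1) by simp
qed

lemma omega_lim_nonempty: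
  assumes "compact K" "\<And>t. t \<ge> T \<Longrightarrow> \<theta> t x \<in> K"
  shows "omega_lim \<theta> x \<noteq> {}"
proof -
  have "\<forall>n. \<theta> (T + real n) x \<in> K"
    using assms(2) by simp
  with compact_imp_seq_compact[OF assms(1)] obtain y and r :: "nat \<Rightarrow> nat"
    where "y \<in> K" and r: "strict_mono r" "((\<lambda>n. \<theta> (T + real n) x) \<circ> r) \<longlonglongrightarrow> y"
    by (rule seq_compactE)
  have "filterlim (\<lambda>n. real (r n)) at_top sequentially"
    using filterlim_compose[OF filterlim_real_sequentially filterlim_subseq[OF r(1)]] .
  then have "filterlim (\<lambda>n. T + real (r n)) at_top sequentially"
    by (rule filterlim_tendsto_add_at_top[OF tendsto_const])
  then show ?thesis
    using r(2) unfolding omega_lim_def comp_def by blast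
qed

text \<open>Time reversal exchanges the two kinds of limit sets, and preserves orbits and minimal sets. So
facts about \<open>\<alpha>\<close>-limit sets, repellers and \<open>\<alpha>\<close>-shells are the facts about their counterparts for
\<open>reverse_flow \<theta>\<close>.\<close>

lemma C0_flow_reverse: "C0_flow (reverse_flow \<theta>)"
proof
  show "continuous_on UNIV (\<lambda>(t, x). reverse_flow \<theta> t x)"
    unfolding continuous_on_def reverse_flow_def case_prod_beta
    by (intro ballI flow_tendsto tendsto_intros)
qed (simp_all add: reverse_flow_def flow_zero flip: flow_add)

lemma invariant_reverse: "invariant (reverse_flow \<theta>) S = invariant \<theta> S"
proof -
  interpret rev: C0_flow "reverse_flow \<theta>"
    by (rule C0_flow_reverse)
  have "(\<forall>t. \<theta> (- t) x \<in> S) = (\<forall>t. \<theta> t x \<in> S)" for x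
    by (metis minus_minus)
  then show ?thesis
    unfolding invariant_iff rev.invariant_iff by (simp add: reverse_flow_def)
qed

lemma reverse_reverse: "reverse_flow (reverse_flow \<theta>) = \<theta>"
  by (simp add: reverse_flow_def)

lemma omega_lim_reverse: "omega_lim (reverse_flow \<theta>) x = alpha_lim \<theta> x"
proof
  show "omega_lim (reverse_flow \<theta>) x \<subseteq> alpha_lim \<theta> x"
  proof
    fix y assume "y \<in> omega_lim (reverse_flow \<theta>) x"
    then obtain t :: "nat \<Rightarrow> real" where "filterlim t at_top sequentially" "(\<lambda>n. \<theta> (- t n) x) \<longlonglongrightarrow> y"
      unfolding omega_lim_def reverse_flow_def by blast
    then show "y \<in> alpha_lim \<theta> x"
      unfolding alpha_lim_def filterlim_uminus_at_bot by (auto intro!: exI[of _ "\<lambda>n. - t n"])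
  qed
  show "alpha_lim \<theta> x \<subseteq> omega_lim (reverse_flow \<theta>) x"
  proof
    fix y assume "y \<in> alpha_lim \<theta> x"
    then obtain t :: "nat \<Rightarrow> real" where "filterlim t at_bot sequentially" "(\<lambda>n. \<theta> (t n) x) \<longlonglongrightarrow> y"
      unfolding alpha_lim_def by blast
    then show "y \<in> omega_lim (reverse_flow \<theta>) x"
      unfolding omega_lim_def filterlim_uminus_at_bot reverse_flow_def
      by (auto intro!: exI[of _ "\<lambda>n. - t n"])
  qed
qed

lemma alpha_lim_reverse: "alpha_lim (reverse_flow \<theta>) x = omega_lim \<theta> x"
  using C0_flow.omega_lim_reverse[OF C0_flow_reverse] by (simp add: reverse_reverse)

lemma invariant_alpha_lim: "invariant \<theta> (alpha_lim \<theta> x)"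
  using C0_flow.invariant_omega_lim[OF C0_flow_reverse] by (simp add: omega_lim_reverse invariant_reverse)

lemma limits_of_compact_invariant:
  assumes "compact L" "invariant \<theta> L" "x \<in> L"
  shows "omega_lim \<theta> x \<subseteq> L" "omega_lim \<theta> x \<noteq> {}" "alpha_lim \<theta> x \<subseteq> L" "alpha_lim \<theta> x \<noteq> {}"
proof -
  interpret rev: C0_flow "reverse_flow \<theta>"
    by (rule C0_flow_reverse)
  have "\<theta> t x \<in> L" "reverse_flow \<theta> t x \<in> L" for t
    using assms by (auto simp: invariantD reverse_flow_def)
  then show "omega_lim \<theta> x \<subseteq> L" "omega_lim \<theta> x \<noteq> {}" "alpha_lim \<theta> x \<subseteq> L" "alpha_lim \<theta> x \<noteq> {}"
    using omega_lim_subset_closed[of L 0 x] omega_lim_nonempty[of L 0 x]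
      rev.omega_lim_subset_closed[of L 0 x] rev.omega_lim_nonempty[of L 0 x]
      assms(1) compact_imp_closed
    by (auto simp: omega_lim_reverse)
qed

section \<open>Compact minimal sets\<close>

lemma CMin_transfer: "S \<in> CMin \<theta> A \<Longrightarrow> S \<subseteq> B \<Longrightarrow> S \<in> CMin \<theta> B"
  by (simp add: CMin_def)

lemma CMin_mono: "A \<subseteq> B \<Longrightarrow> CMin \<theta> A \<subseteq> CMin \<theta> B"
  by (auto simp: CMin_def)

lemma CMinD:
  assumes "S \<in> CMin \<theta> A"
  shows "S \<subseteq> A" "compact S" "S \<noteq> {}" "closed S" "invariant \<theta> S" "minimal_set \<theta> S"
  using assms by (auto simp: CMin_def minimal_set_def)

lemma minimal_set_subset:
  assumes "minimal_set \<theta> S" "closed T" "invariant \<theta> T" "S \<inter> T \<noteq> {}"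
  shows "S \<subseteq> T"
proof -
  have "closed (S \<inter> T)" "invariant \<theta> (S \<inter> T)"
    using assms by (auto simp: minimal_set_def intro: invariant_Int)
  moreover from assms(1) have
    "\<not> (S \<inter> T \<subset> S \<and> S \<inter> T \<noteq> {} \<and> closed (S \<inter> T) \<and> invariant \<theta> (S \<inter> T))"
    unfolding minimal_set_def by blast
  ultimately show ?thesis
    using assms(4) by blast
qed

lemma minimal_sets_disjoint:
  "minimal_set \<theta> S \<Longrightarrow> minimal_set \<theta> T \<Longrightarrow> S \<noteq> T \<Longrightarrow> S \<inter> T = {}"
  using minimal_set_subset[of S T] minimal_set_subset[of T S]
  by (auto simp: minimal_set_def)

text \<open>Zorn's lemma, applied to the complements, because nested nonempty compact sets have a common
point.\<close>

lemma compact_invariant_contains_minimal: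
  assumes "compact K" "invariant \<theta> K" "K \<noteq> {}"
  obtains S where "S \<in> CMin \<theta> K"
proof -
  define A where "A = {T. T \<subseteq> K \<and> T \<noteq> {} \<and> closed T \<and> invariant \<theta> T}"
  have "\<exists>M\<in>uminus ` A. \<forall>X\<in>uminus ` A. M \<subseteq> X \<longrightarrow> X = M"
  proof (rule subset_Zorn_nonempty)
    have "K \<in> A"
      using assms by (auto simp: A_def compact_imp_closed)
    then show "uminus ` A \<noteq> {}"
      by blast
    fix C assume C: "C \<noteq> {}" "subset.chain (uminus ` A) C"
    define F where "F = uminus ` C"
    have FA: "F \<subseteq> A"
      using C(2) by (force simp: F_def subset_chain_def)
    have chain: "S \<subseteq> T \<or> T \<subseteq> S" if "S \<in> F" "T \<in> F" for S T
      using that C(2) unfolding F_def subset_chain_def by blast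
    have "K \<inter> \<Inter>F \<noteq> {}"
    proof (rule compact_imp_fip[OF assms(1)])
      show "closed T" if "T \<in> F" for T
        using that FA by (auto simp: A_def)
      fix F' assume F': "finite F'" "F' \<subseteq> F"
      show "K \<inter> \<Inter>F' \<noteq> {}"
      proof (cases "F' = {}")
        case False
        have "\<forall>S\<in>F'. \<forall>T\<in>F'. S \<subseteq> T \<or> T \<subseteq> S"
          using F' chain by blast
        with F'(1) False have "\<Inter>F' \<in> F'"
        proof (induction F' rule: finite_ne_induct)
          case (insert T G)
          then have "\<Inter>G \<in> G"
            by blast
          then have "T \<subseteq> \<Inter>G \<or> \<Inter>G \<subseteq> T"
            using insert by (metis insert_subset subset_iff)
          then have "\<Inter>(insert T G) = T \<or> \<Inter>(insert T G) = \<Inter>G"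
            unfolding Inter_insert by blast
          then show ?case
            using \<open>\<Inter>G \<in> G\<close> by (elim disjE) (simp_all only: insert_iff simp_thms)
        qed auto
        then have "\<Inter>F' \<in> A"
          using F'(2) FA by blast
        then show ?thesis
          unfolding A_def by blast
      qed (use assms in auto)
    qed
    moreover have "closed (\<Inter>F)" "invariant \<theta> (\<Inter>F)"
      using FA by (auto simp: A_def invariant_iff intro!: closed_Inter)
    moreover have "\<Inter>F \<subseteq> K"
      using C(1) FA by (auto simp: F_def A_def)
    ultimately have "\<Inter>F \<in> A"
      by (auto simp: A_def)
    moreover have "\<Union>C = - \<Inter>F"
      by (auto simp: F_def)
    ultimately show "\<Union>C \<in> uminus ` A"
      by blast
  qed
  then obtain S where S: "S \<in> A" "\<And>T. T \<in> A \<Longrightarrow> T \<subseteq> S \<Longrightarrow> T = S"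
    by (metis (no_types, lifting) Compl_subset_Compl_iff double_compl imageE imageI)
  have "minimal_set \<theta> S"
    using S unfolding minimal_set_def A_def by blast
  moreover have "compact S"
    using S(1) assms(1) by (metis (mono_tags, lifting) A_def compact_Int_closed inf.absorb_iff2 mem_Collect_eq)
  ultimately show ?thesis
    using that S(1) by (auto simp: CMin_def A_def)
qed

lemma orbit_dense_in_minimal:
  assumes "minimal_set \<theta> S" "y \<in> S"
  shows "S \<subseteq> closure (orbit \<theta> y)"
  using mem_orbit[of y] closure_subset[of "orbit \<theta> y"] assms
  by (intro minimal_set_subset) (auto intro: invariant_closure invariant_orbit)

lemma minimal_set_reverse: "minimal_set (reverse_flow \<theta>) S = minimal_set \<theta> S"
  by (simp add: minimal_set_def invariant_reverse)

lemma CMin_reverse: "CMin (reverse_flow \<theta>) A = CMin \<theta> A"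
  by (simp add: CMin_def minimal_set_reverse)

lemma isolated_min_reverse: "isolated_min (reverse_flow \<theta>) X = isolated_min \<theta> X"
  by (simp add: isolated_min_def minimal_set_reverse CMin_reverse)

section \<open>The Hausdorff topology on compact minimal sets\<close>

text \<open>Otherwise there are \<open>y n\<close> tending to some \<open>l \<in> X\<close> whose orbits stay \<open>e\<close>-away from points of \<open>X\<close>
that tend to some \<open>m \<in> X\<close>. But the orbit of \<open>l\<close> comes arbitrarily close to \<open>m\<close>, and the orbits of
\<open>y n\<close> follow it there.\<close>

lemma nearby_orbits_cover_minimal_set:
  assumes X: "X \<in> CMin \<theta> UNIV" and "e > 0"
  shows "\<exists>d>0. \<forall>y x. infdist y X < d \<longrightarrow> x \<in> X \<longrightarrow> (\<exists>t. dist (\<theta> t y) x < e)"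
proof (rule ccontr)
  assume "\<not> ?thesis"
  then have "\<not> (\<forall>y x. infdist y X < d \<longrightarrow> x \<in> X \<longrightarrow> (\<exists>t. dist (\<theta> t y) x < e))" if "d > 0" for d
    using that by blast
  then have "\<exists>y x. infdist y X < d \<and> x \<in> X \<and> (\<forall>t. e \<le> dist (\<theta> t y) x)" if "d > 0" for d
    using that by (simp add: not_less)
  then have "\<exists>y x. infdist y X < inverse (Suc n) \<and> x \<in> X \<and> (\<forall>t. e \<le> dist (\<theta> t y) x)" for n
    by simp
  then obtain y x where yx: "\<And>n. infdist (y n) X < inverse (Suc n)" "\<And>n. x n \<in> X"
    "\<And>n t. e \<le> dist (\<theta> t (y n)) (x n)"
    by metis
  obtain l m and r :: "nat \<Rightarrow> nat" where l: "l \<in> X" "m \<in> X" and "strict_mono r"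
    and yl: "(\<lambda>n. y (r n)) \<longlonglongrightarrow> l" and xl: "(\<lambda>n. x (r n)) \<longlonglongrightarrow> m"
    by (rule convergent_subsequence_near_compact[OF CMinD(2,3)[OF X] yx(1) CMinD(2)[OF X] yx(2)])
  have "m \<in> closure (orbit \<theta> l)"
    using orbit_dense_in_minimal[OF CMinD(6)[OF X] l(1)] l(2) by blast
  then obtain t where t: "dist (\<theta> t l) m < e"
    using \<open>e > 0\<close> unfolding closure_approachable orbit_def by blast
  have "(\<lambda>n. dist (\<theta> t (y (r n))) (x (r n))) \<longlonglongrightarrow> dist (\<theta> t l) m"
    by (intro tendsto_intros flow_tendsto yl xl)
  then have "e \<le> dist (\<theta> t l) m"
    using yx(3) by (intro LIMSEQ_le_const) auto
  then show False
    using t by simp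
qed

lemma hausdorff_dist_less_imp_subset:
  assumes "X \<in> CMin \<theta> UNIV" "Y \<in> CMin \<theta> UNIV" "hausdorff_dist X Y < e"
  shows "Y \<subseteq> set_ball X e"
proof
  fix y assume "y \<in> Y"
  then have "infdist y X \<le> hausdorff_dist X Y"
    using infdist_le_excess[of Y y X] CMinD[OF assms(1)] CMinD[OF assms(2)]
    by (auto simp: hausdorff_dist_def)
  then show "y \<in> set_ball X e"
    using assms CMinD(3)[OF assms(1)] by (simp add: set_ball_eq_infdist)
qed

lemma subset_imp_hausdorff_dist_less:
  assumes X: "X \<in> CMin \<theta> UNIV" and "e > 0"
  obtains d where "d > 0" "\<And>Y. Y \<in> CMin \<theta> (set_ball X d) \<Longrightarrow> hausdorff_dist X Y < e"
proof -
  obtain d where d: "d > 0" "\<And>y x. infdist y X < d \<Longrightarrow> x \<in> X \<Longrightarrow> \<exists>t. dist (\<theta> t y) x < e / 2"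
    using nearby_orbits_cover_minimal_set[OF X half_gt_zero[OF \<open>e > 0\<close>]] by metis
  have "hausdorff_dist X Y < e" if Y: "Y \<in> CMin \<theta> (set_ball X (min d (e / 2)))" for Y
  proof -
    have near: "infdist y X < d" "infdist y X < e / 2" if "y \<in> Y" for y
      using that CMinD(1)[OF Y] CMinD(3)[OF X] by (auto simp: set_ball_eq_infdist)
    have "excess X Y \<le> e / 2"
      unfolding excess_def using CMinD(3)[OF Y] near(2) by (intro cSUP_least) (auto intro: less_imp_le)
    moreover have "excess Y X \<le> e / 2"
      unfolding excess_def
    proof (rule cSUP_least[OF CMinD(3)[OF X]])
      fix x assume "x \<in> X"
      obtain y where "y \<in> Y"
        using CMinD(3)[OF Y] by blast
      then obtain t where "dist (\<theta> t y) x < e / 2"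
        using d(2) near(1) \<open>x \<in> X\<close> by blast
      moreover have "\<theta> t y \<in> Y"
        using invariantD[OF CMinD(5)[OF Y] \<open>y \<in> Y\<close>] .
      ultimately show "infdist x Y \<le> e / 2"
        by (intro infdist_le2[of "\<theta> t y"]) (simp_all add: dist_commute)
    qed
    ultimately show ?thesis
      using \<open>e > 0\<close> by (auto simp: hausdorff_dist_def)
  qed
  then show ?thesis
    using that[of "min d (e / 2)"] d(1) \<open>e > 0\<close> by simp
qed

text \<open>Lying in a small neighbourhood of \<open>X\<close> already means being Hausdorff-close to \<open>X\<close>, for minimal
sets.\<close>

lemma openin_CMin_topology_iff:
  "openin (CMin_topology \<theta>) S \<longleftrightarrow>
     S \<subseteq> CMin \<theta> UNIV \<and> (\<forall>X\<in>S. \<exists>e>0. CMin \<theta> (set_ball X e) \<subseteq> S)"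
proof -
  interpret H: Metric_space "CMin \<theta> UNIV" hausdorff_dist
    by (rule Metric_space_CMin)
  have eq: "(\<exists>r>0. H.mball X r \<subseteq> S) \<longleftrightarrow> (\<exists>e>0. CMin \<theta> (set_ball X e) \<subseteq> S)"
    if X: "X \<in> CMin \<theta> UNIV" for X
  proof
    assume "\<exists>r>0. H.mball X r \<subseteq> S"
    then obtain r where r: "r > 0" "H.mball X r \<subseteq> S"
      by blast
    obtain d where d: "d > 0" "\<And>Y. Y \<in> CMin \<theta> (set_ball X d) \<Longrightarrow> hausdorff_dist X Y < r"
      using subset_imp_hausdorff_dist_less[OF X r(1)] by metis
    have "CMin \<theta> (set_ball X d) \<subseteq> H.mball X r"
      using X d(2) CMin_mono[of "set_ball X d" UNIV] by auto
    then show "\<exists>e>0. CMin \<theta> (set_ball X e) \<subseteq> S"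
      using r(2) d(1) by blast
  next
    assume "\<exists>e>0. CMin \<theta> (set_ball X e) \<subseteq> S"
    then obtain e where e: "e > 0" "CMin \<theta> (set_ball X e) \<subseteq> S"
      by blast
    have "H.mball X e \<subseteq> CMin \<theta> (set_ball X e)"
      using CMin_transfer hausdorff_dist_less_imp_subset[OF X] by (metis H.in_mball subsetI)
    then show "\<exists>r>0. H.mball X r \<subseteq> S"
      using e by blast
  qed
  have "(\<forall>X\<in>S. \<exists>r>0. H.mball X r \<subseteq> S) \<longleftrightarrow> (\<forall>X\<in>S. \<exists>e>0. CMin \<theta> (set_ball X e) \<subseteq> S)"
    if "S \<subseteq> CMin \<theta> UNIV"
    by (rule ball_cong[OF refl], rule eq) (use that in blast)
  then show ?thesis
    unfolding CMin_topology_def H.openin_mtopology Ball_def by blast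
qed

lemma topspace_CMin_topology: "topspace (CMin_topology \<theta>) = CMin \<theta> UNIV"
  unfolding CMin_topology_def using Metric_space.topspace_mtopology[OF Metric_space_CMin] .

section \<open>Isolated minimal sets\<close>

text \<open>The definition of isolation speaks of all minimal sets; inside a compact collar these are
compact.\<close>

lemma isolated_min_iff:
  assumes "locally compact (UNIV :: 'a set)"
  shows "isolated_min \<theta> X \<longleftrightarrow> X \<in> CMin \<theta> UNIV \<and> (\<exists>e>0. CMin \<theta> (set_ball X e) \<subseteq> {X})"
proof (cases "X \<in> CMin \<theta> UNIV")
  case True
  note X = CMinD[OF True]
  show ?thesis
  proof
    assume "isolated_min \<theta> X"
    then obtain U where U: "X \<subseteq> interior U" "\<And>S. S \<subseteq> U - X \<Longrightarrow> \<not> minimal_set \<theta> S"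
      unfolding isolated_min_def nbhd_def by blast
    obtain d where d: "d > 0" "{y. infdist y X \<le> d} \<subseteq> interior U"
      by (rule collar_subset_open[OF X(2,3) open_interior U(1)])
    have "S = X" if S: "S \<in> CMin \<theta> (set_ball X d)" for S
    proof (rule ccontr)
      assume "S \<noteq> X"
      then have "S \<inter> X = {}"
        using minimal_sets_disjoint CMinD(6)[OF S] X(6) by blast
      moreover have "S \<subseteq> U"
        using CMinD(1)[OF S] d(2) interior_subset[of U] X(3) by (force simp: set_ball_eq_infdist)
      ultimately show False
        using U(2)[of S] CMinD(6)[OF S] by blast
    qed
    then show "X \<in> CMin \<theta> UNIV \<and> (\<exists>e>0. CMin \<theta> (set_ball X e) \<subseteq> {X})"
      using True d(1) by blast
  next
    assume "X \<in> CMin \<theta> UNIV \<and> (\<exists>e>0. CMin \<theta> (set_ball X e) \<subseteq> {X})"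
    then obtain e where e: "e > 0" "CMin \<theta> (set_ball X e) \<subseteq> {X}"
      by blast
    obtain d where d: "d > 0" "compact {y. infdist y X \<le> d}" "{y. infdist y X \<le> d} \<subseteq> set_ball X e"
      by (rule compact_collar[OF assms X(2,3) open_set_ball subset_set_ball[OF e(1)]])
    have False if S: "S \<subseteq> {y. infdist y X \<le> d} - X" "minimal_set \<theta> S" for S
    proof -
      have "closed S"
        using S(2) by (simp add: minimal_set_def)
      moreover have "S = {y. infdist y X \<le> d} \<inter> S"
        using S(1) by blast
      ultimately have "compact S"
        using compact_Int_closed[OF d(2), of S] by simp
      then have "S \<in> CMin \<theta> (set_ball X e)"
        using S d(3) by (auto simp: CMin_def)
      then show False
        using e(2) S X(3) by blast
    qed
    then show "isolated_min \<theta> X"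
      unfolding isolated_min_def using True nbhd_collar[OF d(1), of X] by blast
  qed
qed (simp add: isolated_min_def)

lemma openin_isolated_min:
  assumes "locally compact (UNIV :: 'a set)"
  shows "openin (CMin_topology \<theta>) {X \<in> CMin \<theta> UNIV. isolated_min \<theta> X}"
  unfolding openin_CMin_topology_iff
proof (intro conjI ballI)
  fix X assume "X \<in> {X \<in> CMin \<theta> UNIV. isolated_min \<theta> X}"
  then obtain e where "X \<in> CMin \<theta> UNIV" "isolated_min \<theta> X" "e > 0" "CMin \<theta> (set_ball X e) \<subseteq> {X}"
    using isolated_min_iff[OF assms] by auto
  then show "\<exists>e>0. CMin \<theta> (set_ball X e) \<subseteq> {X \<in> CMin \<theta> UNIV. isolated_min \<theta> X}"
    by blast
qed auto

text \<open>An isolated \<open>X\<close> is the only minimal set in some finite union of rational balls, and there are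
countably many such unions.\<close>

lemma countable_isolated_min:
  fixes D :: "'a set"
  assumes lc: "locally compact (UNIV :: 'a set)" and D: "countable D" "closure D = UNIV"
  shows "countable {X. isolated_min \<theta> X}"
proof -
  define P where "P = D \<times> (UNIV :: rat set)"
  define W where "W F = (\<Union>(d, q)\<in>F. ball d (of_rat q))" for F :: "('a \<times> rat) set"
  have "\<exists>F. finite F \<and> F \<subseteq> P \<and> X \<subseteq> W F \<and> CMin \<theta> (W F) \<subseteq> {X}" if "isolated_min \<theta> X" for X
  proof -
    obtain e where e: "e > 0" "CMin \<theta> (set_ball X e) \<subseteq> {X}" and X: "X \<in> CMin \<theta> UNIV"
      using iffD1[OF isolated_min_iff[OF lc] \<open>isolated_min \<theta> X\<close>] by auto
    define Q where "Q = {(d, q) \<in> P. ball d (of_rat q) \<subseteq> set_ball X e}"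
    have "X \<subseteq> (\<Union>p\<in>Q. W {p})"
    proof
      fix x assume "x \<in> X"
      then have "x \<in> set_ball X e"
        using subset_set_ball e(1) by blast
      then obtain d q where "d \<in> D" "x \<in> ball d (of_rat q)" "ball d (of_rat q) \<subseteq> set_ball X e"
        by (rule dense_rat_ball[OF D(2) open_set_ball])
      then show "x \<in> (\<Union>p\<in>Q. W {p})"
        by (force simp: Q_def P_def W_def)
    qed
    then obtain F where F: "F \<subseteq> Q" "finite F" "X \<subseteq> (\<Union>p\<in>F. W {p})"
      using compactE_image[OF CMinD(2)[OF X], of Q "\<lambda>p. W {p}"] by (auto simp: W_def)
    have "W F \<subseteq> set_ball X e"
      using F(1) by (fastforce simp: W_def Q_def)
    then have "CMin \<theta> (W F) \<subseteq> {X}"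
      using CMin_mono[of "W F" "set_ball X e"] e(2) by blast
    moreover have "X \<subseteq> W F"
      using F(3) by (auto simp: W_def)
    moreover have "F \<subseteq> P"
      using F(1) by (auto simp: Q_def)
    ultimately show ?thesis
      using F(2) by blast
  qed
  then obtain f where f: "\<And>X. isolated_min \<theta> X \<Longrightarrow>
      finite (f X) \<and> f X \<subseteq> P \<and> X \<subseteq> W (f X) \<and> CMin \<theta> (W (f X)) \<subseteq> {X}"
    by metis
  have "inj_on f {X. isolated_min \<theta> X}"
  proof (rule inj_onI)
    fix X Y assume XY: "X \<in> {X. isolated_min \<theta> X}" "Y \<in> {X. isolated_min \<theta> X}" "f X = f Y"
    then have "Y \<in> CMin \<theta> UNIV" "Y \<subseteq> W (f X)"
      using f[of Y] by (auto simp: isolated_min_def)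
    then have "Y \<in> CMin \<theta> (W (f X))"
      by (rule CMin_transfer)
    then show "X = Y"
      using f[of X] XY(1) by blast
  qed
  moreover have "countable (f ` {X. isolated_min \<theta> X})"
  proof (rule countable_subset)
    show "f ` {X. isolated_min \<theta> X} \<subseteq> {F. finite F \<and> F \<subseteq> P}"
      using f by blast
    have "countable P"
      using D(1) by (simp add: P_def)
    then show "countable {F. finite F \<and> F \<subseteq> P}"
      by (rule countable_Collect_finite_subset)
  qed
  ultimately show ?thesis
    using countable_image_inj_on by blast
qed

section \<open>Continua of minimal sets\<close>

text \<open>A minimal set in the interior of \<open>C\<close> has another one next to it, and distinct minimal sets are
disjoint. So they have disjoint collars inside \<open>C\<close>.\<close>

lemma CMin_not_isolated_split:
  assumes C: "compact C" "CMin \<theta> (interior C) \<noteq> {}"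
    and no_iso: "\<And>X e. X \<in> CMin \<theta> C \<Longrightarrow> e > 0 \<Longrightarrow> \<not> CMin \<theta> (set_ball X e) \<subseteq> {X}"
  obtains A B where "compact A" "compact B" "A \<subseteq> C" "B \<subseteq> C" "A \<inter> B = {}"
    "CMin \<theta> (interior A) \<noteq> {}" "CMin \<theta> (interior B) \<noteq> {}"
proof -
  have comp: "compact {y. infdist y S \<le> d}" if "{y. infdist y S \<le> d} \<subseteq> interior C" for S d
    using that interior_subset[of C] compact_Int_closed[OF C(1) closed_collar[of S d]]
    by (metis inf.absorb2 order_trans)
  have core: "CMin \<theta> (interior {y. infdist y S \<le> d}) \<noteq> {}" if "S \<in> CMin \<theta> UNIV" "d > 0" for S d
    using CMin_transfer[OF that(1)] nbhd_collar[OF that(2), of S] unfolding nbhd_def by blast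
  obtain Y where Y: "Y \<in> CMin \<theta> (interior C)"
    using C(2) by blast
  have YC: "Y \<in> CMin \<theta> C" and YU: "Y \<in> CMin \<theta> UNIV"
    using Y CMin_mono[OF interior_subset[of C]] CMin_mono[of "interior C" UNIV] by auto
  obtain e where e: "e > 0" "{y. infdist y Y \<le> e} \<subseteq> interior C"
    by (rule collar_subset_open[OF CMinD(2,3)[OF Y] open_interior CMinD(1)[OF Y]])
  obtain Z where Z: "Z \<in> CMin \<theta> (set_ball Y e)" "Z \<noteq> Y"
    using no_iso[OF YC e(1)] by blast
  have ZC: "Z \<subseteq> interior C"
    using CMinD(1)[OF Z(1)] e(2) CMinD(3)[OF Y] by (force simp: set_ball_eq_infdist)
  have ZU: "Z \<in> CMin \<theta> UNIV"
    by (rule CMin_transfer[OF Z(1)]) simp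
  have "Y \<inter> Z = {}"
    using minimal_sets_disjoint CMinD(6)[OF Y] CMinD(6)[OF Z(1)] Z(2) by blast
  then have sub: "Y \<subseteq> interior C - Z"
    using CMinD(1)[OF Y] by blast
  have op: "open (interior C - Z)"
    using CMinD(4)[OF Z(1)] by (intro open_Diff) auto
  obtain a where a: "a > 0" "{y. infdist y Y \<le> a} \<subseteq> interior C - Z"
    by (rule collar_subset_open[OF CMinD(2,3)[OF Y] op sub])
  have sub': "Z \<subseteq> interior C - {y. infdist y Y \<le> a}"
    using ZC a(2) by blast
  have op': "open (interior C - {y. infdist y Y \<le> a})"
    using closed_collar by (intro open_Diff) auto
  obtain b where b: "b > 0" "{y. infdist y Z \<le> b} \<subseteq> interior C - {y. infdist y Y \<le> a}"
    by (rule collar_subset_open[OF CMinD(2,3)[OF Z(1)] op' sub'])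
  show ?thesis
  proof (rule that)
    show "compact {y. infdist y Y \<le> a}" "compact {y. infdist y Z \<le> b}"
      using a(2) b(2) by (auto intro!: comp)
    show "{y. infdist y Y \<le> a} \<subseteq> C" "{y. infdist y Z \<le> b} \<subseteq> C"
      using a(2) b(2) interior_subset[of C] by blast+
    show "{y. infdist y Y \<le> a} \<inter> {y. infdist y Z \<le> b} = {}"
      using b(2) by blast
  qed (use core[OF YU a(1)] core[OF ZU b(1)] in auto)
qed

lemma closed_invariant_kernel:
  assumes "closed S"
  shows "closed {x. \<forall>t. \<theta> t x \<in> S}"
proof -
  have "closed (\<theta> t -` S)" for t
    by (intro continuous_closed_vimage[OF assms]) (auto simp: isCont_def intro!: flow_tendsto tendsto_intros)
  then have "closed (\<Inter>t. \<theta> t -` S)"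
    by blast
  moreover have "(\<Inter>t. \<theta> t -` S) = {x. \<forall>t. \<theta> t x \<in> S}"
    by auto
  ultimately show ?thesis
    by simp
qed

text \<open>A limit of minimal sets need not be minimal, and the sets in the \<open>C n\<close> need not be nested. What
is nested is the largest invariant subset \<open>K n\<close> of \<open>C n\<close>; it is compact and nonempty, and a minimal
set exists in the intersection of all \<open>K n\<close>.\<close>

lemma minimal_set_in_nested_Inter:
  assumes C: "\<And>n. compact (C n)" "decseq C" "\<And>n. CMin \<theta> (C n) \<noteq> {}"
  obtains S where "S \<in> CMin \<theta> (\<Inter>n. C n)"
proof -
  define K where "K n = {x. \<forall>t. \<theta> t x \<in> C n}" for n
  have K_closed: "closed (K n)" for n
    unfolding K_def using closed_invariant_kernel compact_imp_closed[OF C(1)] .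
  have K_ne: "K n \<noteq> {}" for n
  proof -
    obtain S where S: "S \<in> CMin \<theta> (C n)"
      using C(3) by blast
    have "S \<subseteq> K n"
      using invariantD[OF CMinD(5)[OF S]] CMinD(1)[OF S] by (auto simp: K_def)
    then show ?thesis
      using CMinD(3)[OF S] by blast
  qed
  have KC: "K n \<subseteq> C n" for n
    unfolding K_def using flow_zero by (metis (mono_tags, lifting) mem_Collect_eq subsetI)
  have K_mono: "K n \<subseteq> K m" if "m \<le> n" for m n
    using decseqD[OF C(2) that] by (auto simp: K_def)
  have "C 0 \<inter> (\<Inter>n\<in>UNIV. K n) \<noteq> {}"
  proof (rule compact_imp_fip_image[OF C(1)])
    fix I :: "nat set" assume I: "finite I"
    have "K (Max (insert 0 I)) \<subseteq> C 0 \<inter> (\<Inter>n\<in>I. K n)"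
      using I K_mono[of _ "Max (insert 0 I)"] KC[of 0] by (intro Int_greatest INT_greatest) (force | simp)+
    then show "C 0 \<inter> (\<Inter>n\<in>I. K n) \<noteq> {}"
      using K_ne by blast
  qed (use K_closed in auto)
  then have "(\<Inter>n. K n) \<noteq> {}"
    by blast
  moreover have "compact (\<Inter>n. K n)"
  proof -
    have "(\<Inter>n. K n) = C 0 \<inter> (\<Inter>n. K n)"
      using KC by blast
    moreover have "closed (\<Inter>n. K n)"
      using K_closed by blast
    ultimately show ?thesis
      using compact_Int_closed[OF C(1)] by metis
  qed
  moreover have "invariant \<theta> (\<Inter>n. K n)"
    by (auto simp: invariant_iff K_def simp flip: flow_add)
  ultimately obtain S where "S \<in> CMin \<theta> (\<Inter>n. K n)"
    using compact_invariant_contains_minimal by metis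
  moreover have "(\<Inter>n. K n) \<subseteq> (\<Inter>n. C n)"
    using KC by blast
  ultimately show ?thesis
    using that CMin_mono[of "\<Inter>n. K n" "\<Inter>n. C n"] by blast
qed

lemma continuum_of_minimal_sets:
  assumes C: "compact C" "CMin \<theta> (interior C) \<noteq> {}"
    and no_iso: "\<And>X e. X \<in> CMin \<theta> C \<Longrightarrow> e > 0 \<Longrightarrow> \<not> CMin \<theta> (set_ball X e) \<subseteq> {X}"
  shows "(UNIV :: real set) \<lesssim> CMin \<theta> C"
proof -
  define good where "good A \<longleftrightarrow> compact A \<and> A \<subseteq> C \<and> CMin \<theta> (interior A) \<noteq> {}" for A
  have "\<exists>f. good (f True) \<and> good (f False) \<and> f True \<subseteq> A \<and> f False \<subseteq> A \<and> f True \<inter> f False = {}"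
    if A: "good A" for A
  proof -
    have no_iso_A: "\<not> CMin \<theta> (set_ball X e) \<subseteq> {X}" if "X \<in> CMin \<theta> A" "e > 0" for X e
      using that A no_iso CMin_mono[of A C] unfolding good_def by blast
    have "compact A" "CMin \<theta> (interior A) \<noteq> {}"
      using A by (simp_all add: good_def)
    then obtain P Q where "compact P" "compact Q" "P \<subseteq> A" "Q \<subseteq> A" "P \<inter> Q = {}"
      "CMin \<theta> (interior P) \<noteq> {}" "CMin \<theta> (interior Q) \<noteq> {}"
      by (rule CMin_not_isolated_split[OF _ _ no_iso_A])
    then show ?thesis
      using A unfolding good_def by (intro exI[of _ "\<lambda>b. if b then P else Q"]) auto
  qed
  then obtain child where child: "\<And>A. good A \<Longrightarrow> good (child A True) \<and> good (child A False) \<and>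
      child A True \<subseteq> A \<and> child A False \<subseteq> A \<and> child A True \<inter> child A False = {}"
    by metis
  (* The branches of the Cantor scheme are indexed by sets of natural numbers:
     at level n, the branch v turns to the child True iff n is in v. *)
  define node where "node v = rec_nat C (\<lambda>n A. child A (n \<in> v))" for v :: "nat set"
  have node_0: "node v 0 = C" and node_Suc: "node v (Suc n) = child (node v n) (n \<in> v)" for v n
    by (simp_all add: node_def)
  have good: "good (node v n)" for v n
  proof (induction n)
    case 0
    then show ?case
      using C by (simp add: node_0 good_def)
  next
    case (Suc n)
    then show ?case
      using child[OF Suc] by (cases "n \<in> v") (simp_all add: node_Suc)
  qed
  have "node v (Suc n) \<subseteq> node v n" for v n
    using child[OF good[of v n]] by (cases "n \<in> v") (simp_all add: node_Suc)
  then have dec: "decseq (node v)" for v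
    by (simp add: decseq_SucI)
  have "\<exists>S. S \<in> CMin \<theta> (\<Inter>n. node v n)" for v
  proof -
    have "CMin \<theta> (node v n) \<noteq> {}" for n
      using good[of v n] CMin_mono[OF interior_subset[of "node v n"]] unfolding good_def by blast
    moreover have "compact (node v n)" for n
      using good by (simp add: good_def)
    ultimately show ?thesis
      using minimal_set_in_nested_Inter[OF _ dec] by metis
  qed
  then obtain S where S: "\<And>v. S v \<in> CMin \<theta> (\<Inter>n. node v n)"
    by metis
  have "inj S"
  proof (rule injI, rule ccontr)
    fix v w assume eq: "S v = S w" and "v \<noteq> w"
    then have ex: "\<exists>n. (n \<in> v) \<noteq> (n \<in> w)"
      by blast
    define n where "n = (LEAST n. (n \<in> v) \<noteq> (n \<in> w))"
    have n: "(n \<in> v) \<noteq> (n \<in> w)"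
      unfolding n_def using ex by (rule LeastI_ex)
    have agree: "(k \<in> v) = (k \<in> w)" if "k < n" for k
      using not_less_Least that unfolding n_def by blast
    have "node v k = node w k" if "k \<le> n" for k
      using that by (induction k) (simp_all add: node_0 node_Suc agree)
    then have "node v n = node w n"
      by simp
    then have "node v (Suc n) \<inter> node w (Suc n) = {}"
      using n child[OF good[of v n]] by (cases "n \<in> v") (auto simp: node_Suc)
    moreover have "S v \<subseteq> node v (Suc n)" "S v \<subseteq> node w (Suc n)"
      using CMinD(1)[OF S[of v]] CMinD(1)[OF S[of w]] eq by auto
    ultimately show False
      using CMinD(3)[OF S[of v]] by blast
  qed
  moreover have "range S \<subseteq> CMin \<theta> C"
  proof
    fix Y assume "Y \<in> range S"
    then obtain v where "Y = S v"
      by blast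
    moreover have "(\<Inter>n. node v n) \<subseteq> C"
      using node_0 by blast
    ultimately show "Y \<in> CMin \<theta> C"
      using S CMin_mono[of "\<Inter>n. node v n" C] by blast
  qed
  ultimately have "(UNIV :: nat set set) \<lesssim> CMin \<theta> C"
    unfolding lepoll_def by blast
  then show ?thesis
    using lepoll_trans1[OF eqpoll_sym[OF nat_sets_eqpoll_reals]] by blast
qed

lemma c_dense_CMin_open:
  assumes lc: "locally compact (UNIV :: 'a set)" and V: "open V"
    and no_iso: "\<And>X. X \<in> CMin \<theta> V \<Longrightarrow> \<not> isolated_min \<theta> X"
  shows "c_dense_in_itself (CMin \<theta> V)"
  unfolding c_dense_in_itself_def
proof (intro ballI allI impI)
  fix X and e :: real assume X: "X \<in> CMin \<theta> V" and "e > 0"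
  have XU: "X \<in> CMin \<theta> UNIV"
    by (rule CMin_transfer[OF X]) simp
  obtain d where d: "d > 0" "\<And>Y. Y \<in> CMin \<theta> (set_ball X d) \<Longrightarrow> hausdorff_dist X Y < e"
    using subset_imp_hausdorff_dist_less[OF XU \<open>e > 0\<close>] by metis
  have op: "open (V \<inter> set_ball X d)" and sub: "X \<subseteq> V \<inter> set_ball X d"
    by (intro open_Int V open_set_ball Int_greatest CMinD(1)[OF X] subset_set_ball[OF d(1)])+
  obtain c where c: "c > 0" "compact {y. infdist y X \<le> c}"
    "{y. infdist y X \<le> c} \<subseteq> V \<inter> set_ball X d"
    by (rule compact_collar[OF lc CMinD(2,3)[OF X] op sub])
  have "(UNIV :: real set) \<lesssim> CMin \<theta> {y. infdist y X \<le> c}"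
  proof (rule continuum_of_minimal_sets[OF c(2)])
    show "CMin \<theta> (interior {y. infdist y X \<le> c}) \<noteq> {}"
      using CMin_transfer[OF XU] nbhd_collar[OF c(1), of X] unfolding nbhd_def by blast
    fix Y and r :: real assume Y: "Y \<in> CMin \<theta> {y. infdist y X \<le> c}" "r > 0"
    have "Y \<in> CMin \<theta> V" "Y \<in> CMin \<theta> UNIV"
      by (rule CMin_transfer[OF Y(1)], use CMinD(1)[OF Y(1)] c(3) in blast)+
    then show "\<not> CMin \<theta> (set_ball Y r) \<subseteq> {Y}"
      using no_iso isolated_min_iff[OF lc] Y(2) by blast
  qed
  moreover have "CMin \<theta> {y. infdist y X \<le> c} \<subseteq> {Y \<in> CMin \<theta> V. hausdorff_dist X Y < e}"
    using c(3) d(2) CMin_mono[of "{y. infdist y X \<le> c}" "set_ball X d"]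
      CMin_mono[of "{y. infdist y X \<le> c}" V] by blast
  ultimately show "(UNIV :: real set) \<lesssim> {Y \<in> CMin \<theta> V. hausdorff_dist X Y < e}"
    by (rule lepoll_superset)
qed

lemma c_dense_CMin_open_subset:
  assumes "open V" "V \<subseteq> W" "c_dense_in_itself (CMin \<theta> W)"
  shows "c_dense_in_itself (CMin \<theta> V)"
  unfolding c_dense_in_itself_def
proof (intro ballI allI impI)
  fix X and e :: real assume X: "X \<in> CMin \<theta> V" and "e > 0"
  have XW: "X \<in> CMin \<theta> W" and XU: "X \<in> CMin \<theta> UNIV"
    by (rule CMin_transfer[OF X], use CMinD(1)[OF X] assms(2) in blast)+
  obtain d where d: "d > 0" "{y. infdist y X \<le> d} \<subseteq> V"
    by (rule collar_subset_open[OF CMinD(2,3)[OF X] assms(1) CMinD(1)[OF X]])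
  have "{Y \<in> CMin \<theta> W. hausdorff_dist X Y < min e d} \<subseteq> {Y \<in> CMin \<theta> V. hausdorff_dist X Y < e}"
  proof
    fix Y assume Y: "Y \<in> {Y \<in> CMin \<theta> W. hausdorff_dist X Y < min e d}"
    then have YU: "Y \<in> CMin \<theta> UNIV"
      by (auto intro: CMin_transfer)
    have "Y \<subseteq> set_ball X d"
      using hausdorff_dist_less_imp_subset[OF XU YU] Y by auto
    also have "set_ball X d \<subseteq> V"
      using d(2) unfolding set_ball_eq_infdist[OF CMinD(3)[OF X]] by force
    finally show "Y \<in> {Y \<in> CMin \<theta> V. hausdorff_dist X Y < e}"
      using CMin_transfer[OF YU] Y by auto
  qed
  moreover have "min e d > 0"
    using \<open>e > 0\<close> d(1) by simp
  then have "(UNIV :: real set) \<lesssim> {Y \<in> CMin \<theta> W. hausdorff_dist X Y < min e d}"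
    using assms(3) XW unfolding c_dense_in_itself_def by blast
  ultimately show "(UNIV :: real set) \<lesssim> {Y \<in> CMin \<theta> V. hausdorff_dist X Y < e}"
    by (rule lepoll_superset[rotated])
qed

lemma openin_M_10: "openin (CMin_topology \<theta>) (M_10 \<theta>)"
  unfolding openin_CMin_topology_iff
proof (intro conjI ballI)
  show "M_10 \<theta> \<subseteq> CMin \<theta> UNIV"
    by (auto simp: M_10_def)
  fix X assume "X \<in> M_10 \<theta>"
  then obtain e where e: "e > 0" "c_dense_in_itself (CMin \<theta> (set_ball X e))"
    by (auto simp: M_10_def cond10_def)
  have "CMin \<theta> (set_ball X (e / 2)) \<subseteq> M_10 \<theta>"
  proof
    fix Y assume Y: "Y \<in> CMin \<theta> (set_ball X (e / 2))"
    have "set_ball Y (e / 2) \<subseteq> set_ball X e"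
    proof
      fix z assume "z \<in> set_ball Y (e / 2)"
      then obtain y where y: "y \<in> Y" "dist y z < e / 2"
        by (auto simp: set_ball_def)
      then obtain x where "x \<in> X" "dist x y < e / 2"
        using CMinD(1)[OF Y] by (force simp: set_ball_def)
      then show "z \<in> set_ball X e"
        using y dist_triangle_half_r[of y x e z] unfolding set_ball_def
        by (auto simp: dist_commute intro!: bexI[of _ x])
    qed
    then have "c_dense_in_itself (CMin \<theta> (set_ball Y (e / 2)))"
      using c_dense_CMin_open_subset[OF open_set_ball _ e(2)] by blast
    then have "cond10 \<theta> Y"
      unfolding cond10_def using e(1) half_gt_zero by blast
    then show "Y \<in> M_10 \<theta>"
      using CMin_transfer[OF Y subset_UNIV] by (simp add: M_10_def)
  qed
  then show "\<exists>e>0. CMin \<theta> (set_ball X e) \<subseteq> M_10 \<theta>"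
    using e(1) half_gt_zero by blast
qed

text \<open>The condition defining \<open>M_10 \<theta>\<close> yields many compact minimal sets near \<open>X\<close>. As \<open>M_10 \<theta>\<close> is
open, those close enough to \<open>X\<close> satisfy the condition themselves.\<close>

lemma c_dense_M_10: "c_dense_in_itself (M_10 \<theta>)"
  unfolding c_dense_in_itself_def
proof (intro ballI allI impI)
  fix X and e :: real assume X: "X \<in> M_10 \<theta>" and "e > 0"
  obtain a where a: "a > 0" "c_dense_in_itself (CMin \<theta> (set_ball X a))" and XU: "X \<in> CMin \<theta> UNIV"
    using X by (auto simp: M_10_def cond10_def)
  obtain b where b: "b > 0" "CMin \<theta> (set_ball X b) \<subseteq> M_10 \<theta>"
    using openin_M_10 X unfolding openin_CMin_topology_iff by blast
  define c where "c = min a b"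
  have c: "c > 0" "CMin \<theta> (set_ball X c) \<subseteq> M_10 \<theta>"
    using a b CMin_mono[OF set_ball_mono[of c b X]] unfolding c_def by auto
  have "c_dense_in_itself (CMin \<theta> (set_ball X c))"
    using c_dense_CMin_open_subset[OF open_set_ball set_ball_mono a(2)] by (simp add: c_def)
  moreover have "X \<in> CMin \<theta> (set_ball X c)"
    by (rule CMin_transfer[OF XU subset_set_ball[OF c(1)]])
  ultimately have "(UNIV :: real set) \<lesssim> {Y \<in> CMin \<theta> (set_ball X c). hausdorff_dist X Y < e}"
    unfolding c_dense_in_itself_def using \<open>e > 0\<close> by blast
  moreover have "{Y \<in> CMin \<theta> (set_ball X c). hausdorff_dist X Y < e} \<subseteq> {Y \<in> M_10 \<theta>. hausdorff_dist X Y < e}"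
    using c(2) by blast
  ultimately show "(UNIV :: real set) \<lesssim> {Y \<in> M_10 \<theta>. hausdorff_dist X Y < e}"
    by (rule lepoll_superset)
qed

lemma M_10_eqpoll_reals:
  fixes D :: "'a set"
  assumes D: "countable D" "closure D = UNIV" and "M_10 \<theta> \<noteq> {}"
  shows "M_10 \<theta> \<approx> (UNIV :: real set)"
proof (rule lepoll_antisym)
  have "M_10 \<theta> \<subseteq> {A. closed A}"
    using CMinD(4) by (auto simp: M_10_def)
  then show "M_10 \<theta> \<lesssim> (UNIV :: real set)"
    using closed_sets_lepoll_reals[OF D] subset_imp_lepoll lepoll_trans by metis
  obtain X where "X \<in> M_10 \<theta>"
    using assms(3) by blast
  then have "(UNIV :: real set) \<lesssim> {Y \<in> M_10 \<theta>. hausdorff_dist X Y < 1}"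
    using c_dense_M_10 unfolding c_dense_in_itself_def by simp
  then show "(UNIV :: real set) \<lesssim> M_10 \<theta>"
    by (rule lepoll_superset) blast
qed

lemma isolated_min_not_M_10:
  assumes lc: "locally compact (UNIV :: 'a set)" and "isolated_min \<theta> X"
  shows "X \<notin> M_10 \<theta>"
proof
  assume X: "X \<in> M_10 \<theta>"
  obtain e where e: "e > 0" "CMin \<theta> (set_ball X e) \<subseteq> {X}" and XU: "X \<in> CMin \<theta> UNIV"
    using iffD1[OF isolated_min_iff[OF lc] assms(2)] by auto
  have "{Y \<in> M_10 \<theta>. hausdorff_dist X Y < e} \<subseteq> {X}"
  proof
    fix Y assume Y: "Y \<in> {Y \<in> M_10 \<theta>. hausdorff_dist X Y < e}"
    then have YU: "Y \<in> CMin \<theta> UNIV"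
      by (simp add: M_10_def)
    have "Y \<in> CMin \<theta> (set_ball X e)"
      using CMin_transfer[OF YU] hausdorff_dist_less_imp_subset[OF XU YU] Y by blast
    then show "Y \<in> {X}"
      using e(2) by blast
  qed
  moreover have "(UNIV :: real set) \<lesssim> {Y \<in> M_10 \<theta>. hausdorff_dist X Y < e}"
    using c_dense_M_10 X e(1) unfolding c_dense_in_itself_def by blast
  ultimately have "(UNIV :: real set) \<lesssim> {X}"
    by (rule lepoll_superset[rotated])
  then obtain f :: "real \<Rightarrow> 'a set" where f: "inj f" "range f \<subseteq> {X}"
    unfolding lepoll_def by blast
  then have "finite (range f)"
    by (meson finite.emptyI finite.insertI finite_subset)
  then show False
    using f(1) finite_imageD infinite_UNIV_char_0 by blast
qed

lemma isolated_min_dense: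
  assumes lc: "locally compact (UNIV :: 'a set)"
  shows "CMin \<theta> UNIV - M_10 \<theta> \<subseteq> CMin_topology \<theta> closure_of {X \<in> CMin \<theta> UNIV. isolated_min \<theta> X}"
proof
  fix X assume X: "X \<in> CMin \<theta> UNIV - M_10 \<theta>"
  have "\<exists>Y. Y \<in> {X \<in> CMin \<theta> UNIV. isolated_min \<theta> X} \<and> Y \<in> T"
    if T: "X \<in> T" "openin (CMin_topology \<theta>) T" for T
  proof (rule ccontr)
    assume no: "\<not> ?thesis"
    obtain e where e: "e > 0" "CMin \<theta> (set_ball X e) \<subseteq> T"
      using T openin_CMin_topology_iff by blast
    have "\<not> isolated_min \<theta> Y" if "Y \<in> CMin \<theta> (set_ball X e)" for Y
      using no e(2) that CMin_transfer[OF that subset_UNIV] by blast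
    then have "c_dense_in_itself (CMin \<theta> (set_ball X e))"
      by (rule c_dense_CMin_open[OF lc open_set_ball])
    then have "X \<in> M_10 \<theta>"
      using X e(1) by (auto simp: M_10_def cond10_def)
    then show False
      using X by blast
  qed
  then show "X \<in> CMin_topology \<theta> closure_of {X \<in> CMin \<theta> UNIV. isolated_min \<theta> X}"
    using X unfolding in_closure_of topspace_CMin_topology by blast
qed

section \<open>Orbits entering and staying near a compact invariant set\<close>

text \<open>Points of \<open>X\<close> never leave \<open>X\<close>, so points close to \<open>X\<close> need a long time to leave a collar, in either
time direction.\<close>

lemma slow_escape:
  assumes X: "compact X" "X \<noteq> {}" "invariant \<theta> X" and "d > 0"
  shows "\<exists>h>0. \<forall>q s. infdist q X < h \<longrightarrow> \<bar>s\<bar> \<le> T \<longrightarrow> infdist (\<theta> s q) X < d"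
proof (rule ccontr)
  assume "\<not> ?thesis"
  then have "\<not> (\<forall>q s. infdist q X < h \<longrightarrow> \<bar>s\<bar> \<le> T \<longrightarrow> infdist (\<theta> s q) X < d)" if "h > 0" for h
    using that by blast
  then have "\<exists>q s. infdist q X < h \<and> \<bar>s\<bar> \<le> T \<and> d \<le> infdist (\<theta> s q) X" if "h > 0" for h
    using that by (simp add: not_less)
  then have "\<exists>q s. infdist q X < inverse (Suc n) \<and> \<bar>s\<bar> \<le> T \<and> d \<le> infdist (\<theta> s q) X" for n
    by simp
  then obtain q s where qs: "\<And>n. infdist (q n) X < inverse (Suc n)" "\<And>n. \<bar>s n\<bar> \<le> T"
    "\<And>n. d \<le> infdist (\<theta> (s n) (q n)) X"
    by metis
  have s: "s n \<in> {-T..T}" for n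
    using qs(2)[of n] by auto
  obtain l m and r :: "nat \<Rightarrow> nat" where l: "l \<in> X" "m \<in> {-T..T}" and "strict_mono r"
    and ql: "(\<lambda>n. q (r n)) \<longlonglongrightarrow> l" and sl: "(\<lambda>n. s (r n)) \<longlonglongrightarrow> m"
    by (rule convergent_subsequence_near_compact[OF X(1,2) qs(1) compact_Icc s])
  have "(\<lambda>n. infdist (\<theta> (s (r n)) (q (r n))) X) \<longlonglongrightarrow> infdist (\<theta> m l) X"
    by (intro tendsto_intros flow_tendsto ql sl)
  then have "d \<le> infdist (\<theta> m l) X"
    using qs(3) by (intro LIMSEQ_le_const) auto
  then show False
    using invariantD[OF X(3) l(1)] \<open>d > 0\<close> by simp
qed

text \<open>An orbit that starts outside the collar of width \<open>d\<close> and is in it from \<open>T - N\<close> to \<open>T\<close> has made its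
last entry up to time \<open>T\<close> before \<open>T - N\<close>. From that entry on it stays in the collar for a time \<open>N\<close> at
least.\<close>

lemma last_entry:
  assumes a: "infdist a X \<ge> d" and "T \<ge> 0"
    and near: "\<And>s. \<bar>s\<bar> \<le> N \<Longrightarrow> infdist (\<theta> s (\<theta> T a)) X < d" and "N \<ge> 0"
  obtains u where "u \<ge> 0" "infdist (\<theta> u a) X = d"
    "\<And>s. 0 \<le> s \<Longrightarrow> s \<le> N \<Longrightarrow> infdist (\<theta> s (\<theta> u a)) X \<le> d"
proof -
  define f where "f t = infdist (\<theta> t a) X" for t
  define A where "A = {0..T} \<inter> {t. d \<le> f t}"
  have f_cont: "continuous_on S f" for S
    unfolding f_def by (intro continuous_intros continuous_on_flow_point)
  have "closed {t. d \<le> f t}"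
    using f_cont[of UNIV] by (intro closed_Collect_le continuous_intros) auto
  then have "compact A"
    unfolding A_def by (intro compact_Int_closed) auto
  moreover have "0 \<in> A"
    using a \<open>T \<ge> 0\<close> by (simp add: A_def f_def flow_zero)
  ultimately obtain u where u: "u \<in> A" "\<And>t. t \<in> A \<Longrightarrow> t \<le> u"
    using compact_attains_sup by (metis empty_iff)
  have near_T: "f t < d" if "\<bar>t - T\<bar> \<le> N" for t
    using near[OF that] by (simp add: f_def flip: flow_add)
  have "f T < d"
    using near_T[of T] \<open>N \<ge> 0\<close> by simp
  (* The maximality of u only gives f u >= d; equality is the intermediate value theorem. *)
  have "\<exists>t\<ge>u. t \<le> T \<and> f t = d"
    using u(1) \<open>f T < d\<close> f_cont by (intro IVT2') (auto simp: A_def)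
  then obtain t where t: "u \<le> t" "t \<le> T" "f t = d"
    by blast
  then have "t \<in> A"
    using u(1) by (simp add: A_def)
  then have "f u = d"
    using u(2)[of t] t by simp
  then have "u < T - N"
    using near_T[of u] u(1) \<open>N \<ge> 0\<close> by (force simp: A_def)
  have "f (s + u) \<le> d" if "0 \<le> s" "s \<le> N" for s
  proof (rule ccontr)
    assume gt: "\<not> ?thesis"
    then have "s + u \<in> A"
      using u(1) that \<open>u < T - N\<close> by (auto simp: A_def)
    then have "s = 0"
      using u(2)[of "s + u"] that by simp
    then show False
      using gt \<open>f u = d\<close> by simp
  qed
  then show ?thesis
    using that[of u] u(1) \<open>f u = d\<close> by (auto simp: A_def f_def flow_add)
qed

lemma limit_of_entries:
  assumes K: "compact {y. infdist y X \<le> d}" and b: "\<And>n. infdist (b n) X = d"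
    and stay: "\<And>n s. 0 \<le> s \<Longrightarrow> s \<le> real n \<Longrightarrow> infdist (\<theta> s (b n)) X \<le> d"
  obtains r :: "nat \<Rightarrow> nat" and w where "strict_mono r" "(\<lambda>n. b (r n)) \<longlonglongrightarrow> w"
    "infdist w X = d" "\<forall>s\<ge>0. infdist (\<theta> s w) X \<le> d"
proof -
  have "\<forall>n. b n \<in> {y. infdist y X \<le> d}"
    using b by simp
  with compact_imp_seq_compact[OF K] obtain w and r :: "nat \<Rightarrow> nat"
    where "w \<in> {y. infdist y X \<le> d}" and r: "strict_mono r" "(b \<circ> r) \<longlonglongrightarrow> w"
    by (rule seq_compactE)
  have bw: "(\<lambda>n. b (r n)) \<longlonglongrightarrow> w"
    using r(2) by (simp add: o_def)
  have "(\<lambda>n. infdist (b (r n)) X) \<longlonglongrightarrow> infdist w X"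
    by (intro tendsto_intros bw)
  then have "infdist w X = d"
    unfolding b by (simp add: LIMSEQ_const_iff)
  moreover have "infdist (\<theta> s w) X \<le> d" if "s \<ge> 0" for s
  proof (rule LIMSEQ_le_const2)
    show "(\<lambda>n. infdist (\<theta> s (b (r n))) X) \<longlonglongrightarrow> infdist (\<theta> s w) X"
      by (intro tendsto_intros flow_tendsto bw)
    obtain N :: nat where "s \<le> real N"
      using real_arch_simple by blast
    then have "s \<le> real (r n)" if "n \<ge> N" for n
      using that seq_suble[OF r(1), of n] by linarith
    then show "\<exists>N. \<forall>n\<ge>N. infdist (\<theta> s (b (r n))) X \<le> d"
      using stay[OF \<open>s \<ge> 0\<close>] by blast
  qed
  ultimately show ?thesis
    using that[OF r(1) bw] by blast
qed

text \<open>The orbit of \<open>y\<close> comes near \<open>z\<close>, hence outside the collar, and later close to \<open>X\<close>, again and again.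
Its last entries in between happen at arbitrarily late times, so a limit of them lies in the
\<open>\<omega>\<close>-limit set.\<close>

lemma entry_of_omega_limit:
  assumes X: "compact X" "X \<noteq> {}" "invariant \<theta> X" "X \<subseteq> omega_lim \<theta> y"
    and d: "d > 0" "compact {y. infdist y X \<le> d}"
    and z: "z \<in> omega_lim \<theta> y" "infdist z X > d"
  obtains w where "w \<in> omega_lim \<theta> y" "infdist w X = d" "\<And>s. s \<ge> 0 \<Longrightarrow> infdist (\<theta> s w) X \<le> d"
proof -
  obtain p where p: "p \<in> X"
    using X(2) by blast
  have "\<exists>t\<ge>real n. infdist (\<theta> t y) X = d \<and>
      (\<forall>s. 0 \<le> s \<longrightarrow> s \<le> real n \<longrightarrow> infdist (\<theta> s (\<theta> t y)) X \<le> d)" for n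
  proof -
    obtain h where h: "h > 0" "\<And>q s. infdist q X < h \<Longrightarrow> \<bar>s\<bar> \<le> real n \<Longrightarrow> infdist (\<theta> s q) X < d"
      using slow_escape[OF X(1-3) d(1)] by metis
    obtain t1 where t1: "t1 \<ge> real n" "dist (\<theta> t1 y) z < infdist z X - d"
      using z unfolding omega_lim_iff by (metis diff_gt_0_iff_gt)
    have far: "infdist (\<theta> t1 y) X \<ge> d"
      using t1(2) infdist_triangle[of z X "\<theta> t1 y"] by (simp add: dist_commute)
    have "p \<in> omega_lim \<theta> y"
      using X(4) p by blast
    then obtain t2 where t2: "t2 \<ge> t1" "dist (\<theta> t2 y) p < h"
      unfolding omega_lim_iff using h(1) by blast
    have eq: "\<theta> (t2 - t1) (\<theta> t1 y) = \<theta> t2 y"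
      by (simp flip: flow_add)
    have "infdist (\<theta> t2 y) X < h"
      using infdist_le[OF p, of "\<theta> t2 y"] t2(2) by simp
    then have near: "infdist (\<theta> s (\<theta> (t2 - t1) (\<theta> t1 y))) X < d" if "\<bar>s\<bar> \<le> real n" for s
      unfolding eq using h(2) that by blast
    have "t2 - t1 \<ge> 0"
      using t2(1) by simp
    then obtain u where u: "u \<ge> 0" "infdist (\<theta> u (\<theta> t1 y)) X = d"
      "\<And>s. 0 \<le> s \<Longrightarrow> s \<le> real n \<Longrightarrow> infdist (\<theta> s (\<theta> u (\<theta> t1 y))) X \<le> d"
      using last_entry[OF far _ near] of_nat_0_le_iff by metis
    then show ?thesis
      using t1(1) by (intro exI[of _ "u + t1"]) (simp add: flow_add)
  qed
  then obtain t where t: "\<And>n. t n \<ge> real n" "\<And>n. infdist (\<theta> (t n) y) X = d"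
    "\<And>n s. 0 \<le> s \<Longrightarrow> s \<le> real n \<Longrightarrow> infdist (\<theta> s (\<theta> (t n) y)) X \<le> d"
    by metis
  obtain r :: "nat \<Rightarrow> nat" and w where r: "strict_mono r" "(\<lambda>n. \<theta> (t (r n)) y) \<longlonglongrightarrow> w"
    and w: "infdist w X = d" "\<forall>s\<ge>0. infdist (\<theta> s w) X \<le> d"
    by (rule limit_of_entries[OF d(2) t(2,3)])
  have "filterlim t at_top sequentially"
    by (rule filterlim_at_top_mono[OF filterlim_real_sequentially]) (use t(1) in auto)
  then have "filterlim (\<lambda>n. t (r n)) at_top sequentially"
    by (rule filterlim_compose[OF _ filterlim_subseq[OF r(1)]])
  then have "w \<in> omega_lim \<theta> y"
    unfolding omega_lim_def using r(2) by blast
  then show ?thesis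
    using that[OF _ w(1)] w(2) by blast
qed

text \<open>If \<open>X\<close> is not negatively stable, points arbitrarily close to \<open>X\<close> come from outside a fixed collar. Their
last entries into the collar have a limit.\<close>

lemma entry_of_not_neg_stable:
  assumes lc: "locally compact (UNIV :: 'a set)"
    and X: "compact X" "X \<noteq> {}" "invariant \<theta> X" and unstable: "\<not> neg_stable \<theta> X"
    and B: "open B" "X \<subseteq> B"
  obtains d w where "d > 0" "{y. infdist y X \<le> d} \<subseteq> B"
    "infdist w X = d" "\<forall>s\<ge>0. infdist (\<theta> s w) X \<le> d"
proof -
  obtain U where U: "X \<subseteq> interior U"
    "\<And>V. nbhd X V \<Longrightarrow> \<not> (\<Union>x\<in>V. neg_orbit \<theta> x) \<subseteq> U"
    using unstable unfolding neg_stable_def nbhd_def by blast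
  have op: "open (B \<inter> interior U)" and sub: "X \<subseteq> B \<inter> interior U"
    using B U(1) by auto
  obtain d where d: "d > 0" "compact {y. infdist y X \<le> d}" "{y. infdist y X \<le> d} \<subseteq> B \<inter> interior U"
    by (rule compact_collar[OF lc X(1,2) op sub])
  have "\<exists>b. infdist b X = d \<and> (\<forall>s. 0 \<le> s \<longrightarrow> s \<le> real n \<longrightarrow> infdist (\<theta> s b) X \<le> d)" for n
  proof -
    obtain h where h: "h > 0" "\<And>q s. infdist q X < h \<Longrightarrow> \<bar>s\<bar> \<le> real n \<Longrightarrow> infdist (\<theta> s q) X < d"
      using slow_escape[OF X d(1)] by metis
    have "nbhd X {y. infdist y X \<le> h / 2}"
      using h(1) by (intro nbhd_collar) simp
    from U(2)[OF this] obtain v t where v: "infdist v X \<le> h / 2" "t \<le> 0" "\<theta> t v \<notin> U"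
      unfolding neg_orbit_def by blast
    have far: "infdist (\<theta> t v) X \<ge> d"
    proof (rule ccontr)
      assume "\<not> ?thesis"
      then have "\<theta> t v \<in> {y. infdist y X \<le> d}"
        by simp
      then show False
        using d(3) interior_subset[of U] v(3) by blast
    qed
    have "infdist v X < h"
      using v(1) h(1) by linarith
    then have near: "infdist (\<theta> s (\<theta> (- t) (\<theta> t v))) X < d" if "\<bar>s\<bar> \<le> real n" for s
      using h(2) that by simp
    have "- t \<ge> 0"
      using v(2) by simp
    then obtain u where "u \<ge> 0" "infdist (\<theta> u (\<theta> t v)) X = d"
      "\<And>s. 0 \<le> s \<Longrightarrow> s \<le> real n \<Longrightarrow> infdist (\<theta> s (\<theta> u (\<theta> t v))) X \<le> d"
      using last_entry[OF far _ near] of_nat_0_le_iff by metis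
    then show ?thesis
      by blast
  qed
  then obtain b where b: "\<And>n. infdist (b n) X = d"
    "\<And>n s. 0 \<le> s \<Longrightarrow> s \<le> real n \<Longrightarrow> infdist (\<theta> s (b n)) X \<le> d"
    by metis
  obtain r :: "nat \<Rightarrow> nat" and w where "strict_mono r" "(\<lambda>n. b (r n)) \<longlonglongrightarrow> w"
    and w: "infdist w X = d" "\<forall>s\<ge>0. infdist (\<theta> s w) X \<le> d"
    by (rule limit_of_entries[OF d(2) b])
  then show ?thesis
    using that[OF d(1) _ w] d(3) by blast
qed

section \<open>Isolating collars\<close>

text \<open>A collar in which \<open>X\<close> is the only minimal set, in the form in which this is used.\<close>

definition isolating :: "'a set \<Rightarrow> real \<Rightarrow> bool"
  where "isolating X d \<longleftrightarrow> d > 0 \<and> compact {y. infdist y X \<le> d} \<and>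
    (\<forall>L. closed L \<longrightarrow> invariant \<theta> L \<longrightarrow> L \<noteq> {} \<longrightarrow> L \<subseteq> {y. infdist y X \<le> d} \<longrightarrow> X \<subseteq> L)"

lemma isolatingD:
  assumes "isolating X d"
  shows "d > 0" "compact {y. infdist y X \<le> d}"
    "\<And>L. closed L \<Longrightarrow> invariant \<theta> L \<Longrightarrow> L \<noteq> {} \<Longrightarrow> L \<subseteq> {y. infdist y X \<le> d} \<Longrightarrow> X \<subseteq> L"
  using assms unfolding isolating_def by blast+

lemma isolated_min_imp_isolating:
  assumes lc: "locally compact (UNIV :: 'a set)" and "isolated_min \<theta> X"
  obtains d where "isolating X d"
proof -
  obtain e where e: "e > 0" "CMin \<theta> (set_ball X e) \<subseteq> {X}" and XU: "X \<in> CMin \<theta> UNIV"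
    using iffD1[OF isolated_min_iff[OF lc] assms(2)] by auto
  obtain d where d: "d > 0" "compact {y. infdist y X \<le> d}" "{y. infdist y X \<le> d} \<subseteq> set_ball X e"
    by (rule compact_collar[OF lc CMinD(2,3)[OF XU] open_set_ball subset_set_ball[OF e(1)]])
  have "X \<subseteq> L" if L: "closed L" "invariant \<theta> L" "L \<noteq> {}" "L \<subseteq> {y. infdist y X \<le> d}" for L
  proof -
    have "{y. infdist y X \<le> d} \<inter> L = L"
      using L(4) by blast
    then have "compact L"
      using compact_Int_closed[OF d(2) L(1)] by simp
    then obtain S where S: "S \<in> CMin \<theta> L"
      using compact_invariant_contains_minimal L(2,3) by metis
    then have "S \<in> CMin \<theta> (set_ball X e)"
      using CMinD(1)[OF S] L(4) d(3) by (intro CMin_transfer[OF S]) blast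
    then have "S = X"
      using e(2) by blast
    then show ?thesis
      using CMinD(1)[OF S] by simp
  qed
  then have "isolating X d"
    unfolding isolating_def using d by blast
  then show ?thesis
    by (rule that)
qed

lemma isolating_reverse: "C0_flow.isolating (reverse_flow \<theta>) X d \<longleftrightarrow> isolating X d"
  unfolding isolating_def C0_flow.isolating_def[OF C0_flow_reverse] invariant_reverse ..

section \<open>Attractors\<close>

text \<open>A minimal set in the basin contains the limit set of its points, which lies in \<open>X\<close>.\<close>

lemma attractor_imp_isolated_min:
  assumes X: "X \<in> CMin \<theta> UNIV" and "attractor \<theta> X"
  shows "isolated_min \<theta> X"
proof -
  have "\<not> minimal_set \<theta> S" if S: "S \<subseteq> Bplus \<theta> X - X" for S
  proof
    assume min: "minimal_set \<theta> S"
    then obtain x where x: "x \<in> S" and S': "closed S" "invariant \<theta> S"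
      by (auto simp: minimal_set_def)
    then have "omega_lim \<theta> x \<subseteq> S"
      by (intro omega_lim_subset_closed[of _ 0]) (auto intro: invariantD)
    moreover have "omega_lim \<theta> x \<noteq> {}" "omega_lim \<theta> x \<subseteq> X"
      using x S by (auto simp: Bplus_def)
    ultimately show False
      using S by blast
  qed
  then show ?thesis
    using assms unfolding isolated_min_def attractor_def by blast
qed

text \<open>By stability, orbits starting near \<open>X\<close> stay in the isolating collar, so their limit sets contain \<open>X\<close>.
Hence these orbits come arbitrarily close to \<open>X\<close> and, by stability again, stay there. So the limit
sets contain nothing else.\<close>

lemma stable_isolating_imp_attractor:
  assumes X: "X \<in> CMin \<theta> UNIV" and iso: "isolating X d" and st: "stable \<theta> X"
  shows "attractor \<theta> X"
proof -
  have stable: "\<exists>V. nbhd X V \<and> (\<forall>v\<in>V. \<forall>t\<ge>0. infdist (\<theta> t v) X \<le> c)" if c: "c > 0" for c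
  proof -
    obtain V where V: "nbhd X V" "(\<Union>x\<in>V. pos_orbit \<theta> x) \<subseteq> {y. infdist y X \<le> c}"
      using st nbhd_collar[OF c, of X] unfolding stable_def by blast
    have "infdist (\<theta> t v) X \<le> c" if "v \<in> V" "t \<ge> 0" for v t
      using V(2) that unfolding pos_orbit_def by blast
    then show ?thesis
      using V(1) by blast
  qed
  obtain V where V: "nbhd X V" "\<And>v t. v \<in> V \<Longrightarrow> t \<ge> 0 \<Longrightarrow> infdist (\<theta> t v) X \<le> d"
    using stable[OF isolatingD(1)[OF iso]] by blast
  have "V \<subseteq> Bplus \<theta> X"
  proof
    fix x assume "x \<in> V"
    then have stay: "\<theta> t x \<in> {y. infdist y X \<le> d}" if "t \<ge> 0" for t
      using V(2) that by simp
    have ne: "omega_lim \<theta> x \<noteq> {}"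
      using omega_lim_nonempty[OF isolatingD(2)[OF iso] stay] .
    have "omega_lim \<theta> x \<subseteq> {y. infdist y X \<le> d}"
      using omega_lim_subset_closed[OF closed_collar stay] .
    then have sub: "X \<subseteq> omega_lim \<theta> x"
      using isolatingD(3)[OF iso closed_omega_lim invariant_omega_lim ne] by blast
    have "q \<in> X" if q: "q \<in> omega_lim \<theta> x" for q
    proof (rule ccontr)
      assume "q \<notin> X"
      then have pos: "infdist q X > 0"
        using infdist_pos_not_in_closed CMinD(3,4)[OF X] by blast
      obtain W where W: "nbhd X W" "\<And>v t. v \<in> W \<Longrightarrow> t \<ge> 0 \<Longrightarrow> infdist (\<theta> t v) X \<le> infdist q X / 2"
        using stable[OF half_gt_zero[OF pos]] by blast
      obtain p where "p \<in> X"
        using CMinD(3)[OF X] by blast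
      then have "p \<in> interior W" "p \<in> omega_lim \<theta> x"
        using W(1) sub unfolding nbhd_def by auto
      then obtain e where e: "e > 0" "ball p e \<subseteq> W"
        using mem_interior by blast
      obtain t where t: "dist (\<theta> t x) p < e"
        using \<open>p \<in> omega_lim \<theta> x\<close> e(1) unfolding omega_lim_iff by blast
      then have "\<theta> t x \<in> W"
        using e(2) by (auto simp: dist_commute)
      then have "infdist (\<theta> s x) X \<le> infdist q X / 2" if "s \<ge> t" for s
        using W(2)[of "\<theta> t x" "s - t"] that by (simp flip: flow_add)
      then have "omega_lim \<theta> x \<subseteq> {y. infdist y X \<le> infdist q X / 2}"
        by (intro omega_lim_subset_closed[OF closed_collar]) auto
      then show False
        using q pos by auto
    qed
    then show "x \<in> Bplus \<theta> X"
      using ne by (auto simp: Bplus_def)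
  qed
  then have "nbhd X (Bplus \<theta> X)"
    using V(1) interior_mono unfolding nbhd_def by blast
  then show ?thesis
    using st by (simp add: attractor_def)
qed

lemma stable_reverse: "stable (reverse_flow \<theta>) X \<longleftrightarrow> neg_stable \<theta> X"
proof -
  have "pos_orbit (reverse_flow \<theta>) x = neg_orbit \<theta> x" for x
  proof -
    have "(\<exists>t. y = \<theta> (- t) x \<and> 0 \<le> t) = (\<exists>t. y = \<theta> t x \<and> t \<le> 0)" for y
      by (metis minus_minus neg_le_0_iff_le)
    then show ?thesis
      by (simp add: pos_orbit_def neg_orbit_def reverse_flow_def)
  qed
  then show ?thesis
    by (simp add: stable_def neg_stable_def)
qed

lemma neg_stable_reverse: "neg_stable (reverse_flow \<theta>) X \<longleftrightarrow> stable \<theta> X"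
  using C0_flow.stable_reverse[OF C0_flow_reverse, of X] by (simp add: reverse_reverse)

lemma Bplus_reverse: "Bplus (reverse_flow \<theta>) X = Bminus \<theta> X"
  by (simp add: Bplus_def Bminus_def omega_lim_reverse)

lemma attractor_reverse: "attractor (reverse_flow \<theta>) X \<longleftrightarrow> repeller \<theta> X"
  by (simp add: attractor_def repeller_def stable_reverse Bplus_reverse)

section \<open>Shells and trees\<close>

text \<open>If moreover \<open>L\<close> lies in an isolating collar, both limit sets of each point of \<open>L - X\<close> properly
contain \<open>X\<close>. The notion is symmetric under time reversal.\<close>

definition limit_detached :: "'a set \<Rightarrow> 'a set \<Rightarrow> bool"
  where "limit_detached X L \<longleftrightarrow> compact L \<and> invariant \<theta> L \<and> \<not> L \<subseteq> X \<and>
    (\<forall>z\<in>L - X. \<not> alpha_lim \<theta> z \<subseteq> X \<and> \<not> omega_lim \<theta> z \<subseteq> X)"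

lemma limit_detached_reverse:
  "C0_flow.limit_detached (reverse_flow \<theta>) X L \<longleftrightarrow> limit_detached X L"
  unfolding limit_detached_def C0_flow.limit_detached_def[OF C0_flow_reverse]
    invariant_reverse omega_lim_reverse alpha_lim_reverse by (simp add: conj_ac)

text \<open>If the limit set of \<open>z\<close> leaves the collar of width \<open>c\<close>, it contains an entry point \<open>w\<close> of that
collar whose positive half orbit stays in it. The limit set of \<open>w\<close> is then contained in both, and
contains a point outside \<open>X\<close>.\<close>

lemma shrinking_omega_step:
  assumes X: "X \<in> CMin \<theta> UNIV" and iso: "isolating X d" and c: "0 < c" "c \<le> d"
    and L: "omega_lim \<theta> z \<subseteq> {y. infdist y X \<le> d}" "omega_lim \<theta> z \<noteq> {}" "\<not> omega_lim \<theta> z \<subseteq> X"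
    and detached: "\<And>w. w \<in> omega_lim \<theta> z - X \<Longrightarrow> \<not> omega_lim \<theta> w \<subseteq> X"
  obtains y where "y \<in> omega_lim \<theta> z - X" "\<And>t. infdist (\<theta> t y) X \<le> c"
proof (cases "omega_lim \<theta> z \<subseteq> {y. infdist y X \<le> c}")
  case True
  obtain y where y: "y \<in> omega_lim \<theta> z - X"
    using L(3) by blast
  then have "\<theta> t y \<in> omega_lim \<theta> z" for t
    using invariantD[OF invariant_omega_lim] by blast
  then show ?thesis
    using that[OF y] True by blast
next
  case False
  then obtain q where q: "q \<in> omega_lim \<theta> z" "infdist q X > c"
    by force
  have sub: "X \<subseteq> omega_lim \<theta> z"
    using isolatingD(3)[OF iso closed_omega_lim invariant_omega_lim L(2,1)] .
  have "compact {y. infdist y X \<le> c}"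
    using compact_smaller_collar[OF isolatingD(2)[OF iso] c(2)] .
  then obtain w where w: "w \<in> omega_lim \<theta> z" "infdist w X = c" "\<And>s. s \<ge> 0 \<Longrightarrow> infdist (\<theta> s w) X \<le> c"
    using entry_of_omega_limit[OF CMinD(2,3,5)[OF X] sub c(1) _ q] by metis
  have "w \<notin> X"
    using w(2) c(1) by auto
  then obtain y where y: "y \<in> omega_lim \<theta> w" "y \<notin> X"
    using detached w(1) by blast
  have in_collar: "omega_lim \<theta> w \<subseteq> {y. infdist y X \<le> c}"
    by (rule omega_lim_subset_closed[OF closed_collar, of 0]) (use w(3) in simp)
  have "omega_lim \<theta> w \<subseteq> omega_lim \<theta> z"
    by (rule omega_lim_subset_closed[OF closed_omega_lim, of 0])
      (use invariantD[OF invariant_omega_lim w(1)] in simp)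
  moreover have "\<theta> t y \<in> omega_lim \<theta> w" for t
    using invariantD[OF invariant_omega_lim y(1)] .
  ultimately show ?thesis
    using that[of y] y in_collar by blast
qed

lemma limits_of_orbit_in_collar:
  assumes "\<And>t. infdist (\<theta> t z) X \<le> c"
  shows "omega_lim \<theta> z \<subseteq> {y. infdist y X \<le> c}" "alpha_lim \<theta> z \<subseteq> {y. infdist y X \<le> c}"
    "closure (orbit \<theta> z) \<subseteq> {y. infdist y X \<le> c}"
proof -
  interpret rev: C0_flow "reverse_flow \<theta>"
    by (rule C0_flow_reverse)
  show "omega_lim \<theta> z \<subseteq> {y. infdist y X \<le> c}"
    by (rule omega_lim_subset_closed[OF closed_collar, of 0]) (use assms in simp)
  have "omega_lim (reverse_flow \<theta>) z \<subseteq> {y. infdist y X \<le> c}"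
    by (rule rev.omega_lim_subset_closed[OF closed_collar, of 0]) (use assms in \<open>simp add: reverse_flow_def\<close>)
  then show "alpha_lim \<theta> z \<subseteq> {y. infdist y X \<le> c}"
    by (simp add: omega_lim_reverse)
  show "closure (orbit \<theta> z) \<subseteq> {y. infdist y X \<le> c}"
    by (rule closure_minimal[OF _ closed_collar]) (use assms in \<open>auto simp: orbit_def\<close>)
qed

text \<open>The orbit of \<open>y\<close> and its limit sets stay closer to \<open>X\<close> than \<open>z\<close> is.\<close>

lemma not_succ_any_of_smaller:
  assumes "\<And>t. infdist (\<theta> t y) X \<le> c" "c < infdist z X"
  shows "\<not> succ_any \<theta> (orbit \<theta> y) (orbit \<theta> z)"
proof
  assume "succ_any \<theta> (orbit \<theta> y) (orbit \<theta> z)"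
  then have "z \<in> alpha_lim \<theta> y \<union> omega_lim \<theta> y"
    unfolding succ_any_def alpha_orb_orbit omega_orb_orbit using mem_orbit by blast
  then have "infdist z X \<le> c"
    using limits_of_orbit_in_collar(1,2)[of y X c, OF assms(1)] by blast
  then show False
    using assms(2) by simp
qed

lemma excess_closure_orbit:
  assumes "\<And>t. infdist (\<theta> t z) X \<le> c"
  shows "0 \<le> excess X (closure (orbit \<theta> z))" "excess X (closure (orbit \<theta> z)) \<le> c"
proof -
  have le: "infdist y X \<le> c" if "y \<in> closure (orbit \<theta> z)" for y
    using limits_of_orbit_in_collar(3)[of z X c, OF assms] that by blast
  have z: "z \<in> closure (orbit \<theta> z)"
    using mem_orbit closure_subset by blast
  then show "excess X (closure (orbit \<theta> z)) \<le> c"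
    unfolding excess_def using le by (intro cSUP_least) auto
  have "infdist z X \<le> excess X (closure (orbit \<theta> z))"
    unfolding excess_def using le by (intro cSUP_upper[OF z] bdd_aboveI2)
  then show "0 \<le> excess X (closure (orbit \<theta> z))"
    using infdist_nonneg[of z X] by linarith
qed

lemma orbit_in_Orb:
  assumes "invariant \<theta> X" "z \<notin> X" "\<And>t. \<theta> t z \<in> K"
  shows "orbit \<theta> z \<in> Orb \<theta> (K - X)"
proof -
  have "\<theta> t z \<notin> X" for t
    using invariantD[OF assms(1), of "\<theta> t z" "- t"] assms(2) by auto
  then show ?thesis
    using assms(3) by (auto simp: Orb_def orbit_def)
qed

text \<open>In a limit-detached set the shrinking step can be made from every orbit outside \<open>X\<close> in both time
directions, and it leads to an orbit of the same kind. A word of digits prescribes the directions of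
successive steps. The starting orbit belongs to the empty word, so the orbit of the word \<open>0\<close> is
one step away from it.\<close>

lemma limit_detached_imp_tree:
  assumes X: "X \<in> CMin \<theta> UNIV" and iso: "isolating X d"
    and L: "limit_detached X L" "L \<subseteq> {y. infdist y X \<le> d}"
  shows "\<exists>\<Theta> \<psi>. is_tree \<theta> X \<Theta> \<psi>"
proof -
  interpret rev: C0_flow "reverse_flow \<theta>"
    by (rule C0_flow_reverse)
  have cL: "compact L" and iL: "invariant \<theta> L"
    and det: "\<And>z. z \<in> L - X \<Longrightarrow> \<not> alpha_lim \<theta> z \<subseteq> X \<and> \<not> omega_lim \<theta> z \<subseteq> X"
    using L(1) by (auto simp: limit_detached_def)
  have pos: "infdist z X > 0" if "z \<in> L - X" for z
    using infdist_pos_not_in_closed[OF CMinD(4,3)[OF X]] that by blast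
  define step where "step z c = (SOME y. y \<in> L - X \<and> y \<in> (if c = 0 then alpha_lim \<theta> z else omega_lim \<theta> z) \<and>
      (\<forall>t. infdist (\<theta> t y) X \<le> infdist z X / 2))" for z and c :: nat
  have step_ex: "\<exists>y. y \<in> L - X \<and> y \<in> (if c = 0 then alpha_lim \<theta> z else omega_lim \<theta> z) \<and>
      (\<forall>t. infdist (\<theta> t y) X \<le> infdist z X / 2)" if z: "z \<in> L - X" for z and c :: nat
  proof -
    note lims = limits_of_compact_invariant[OF cL iL DiffD1[OF z]]
    have half: "0 < infdist z X / 2" "infdist z X / 2 \<le> d"
      using pos[OF z] z L(2) by (force, force)
    show ?thesis
    proof (cases "c = 0")
      case True
      have "alpha_lim \<theta> z \<subseteq> {y. infdist y X \<le> d}"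
        using lims(3) L(2) by blast
      moreover have "\<not> alpha_lim \<theta> w \<subseteq> X" if "w \<in> alpha_lim \<theta> z - X" for w
        using det that lims(3) by blast
      ultimately obtain y where "y \<in> alpha_lim \<theta> z - X" "\<And>t. infdist (reverse_flow \<theta> t y) X \<le> infdist z X / 2"
        using rev.shrinking_omega_step[of X d "infdist z X / 2" z] X iso half lims(4) det[OF z]
        unfolding omega_lim_reverse CMin_reverse isolating_reverse by metis
      moreover from this have "infdist (\<theta> t y) X \<le> infdist z X / 2" for t
        unfolding reverse_flow_def by (metis minus_minus)
      ultimately show ?thesis
        using True lims(3) by auto
    next
      case False
      have "omega_lim \<theta> z \<subseteq> {y. infdist y X \<le> d}"
        using lims(1) L(2) by blast
      moreover have "\<not> omega_lim \<theta> w \<subseteq> X" if "w \<in> omega_lim \<theta> z - X" for w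
        using det that lims(1) by blast
      ultimately obtain y where "y \<in> omega_lim \<theta> z - X" "\<And>t. infdist (\<theta> t y) X \<le> infdist z X / 2"
        using shrinking_omega_step[OF X iso half _ lims(2)] det[OF z] by metis
      then show ?thesis
        using False lims(1) by auto
    qed
  qed
  have step: "step z c \<in> L - X" "step z c \<in> (if c = 0 then alpha_lim \<theta> z else omega_lim \<theta> z)"
    "infdist (\<theta> t (step z c)) X \<le> infdist z X / 2" if "z \<in> L - X" for z c t
    using someI_ex[OF step_ex[OF that, of c]] unfolding step_def[symmetric] by blast+
  obtain z0 where z0: "z0 \<in> L - X"
    using L(1) unfolding limit_detached_def by blast
  define node where "node b = foldl step z0 b" for b :: "nat list"
  have node_append: "node (b @ [c]) = step (node b) c" for b c
    by (simp add: node_def)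
  have node_L: "node b \<in> L - X" for b
  proof (induction b rule: rev_induct)
    case Nil
    then show ?case
      using z0 by (simp add: node_def)
  next
    case (snoc c b)
    then show ?case
      using step(1)[OF snoc] by (simp add: node_append)
  qed
  have node_small: "infdist (node b) X \<le> infdist z0 X / 2 ^ length b" for b
  proof (induction b rule: rev_induct)
    case Nil
    then show ?case
      by (simp add: node_def)
  next
    case (snoc c b)
    have "infdist (node (b @ [c])) X \<le> infdist (node b) X / 2"
      using step(3)[OF node_L[of b], of 0 c] by (simp add: node_append flow_zero)
    also have "\<dots> \<le> infdist z0 X / 2 ^ length (b @ [c])"
      using snoc by simp
    finally show ?case .
  qed
  have orbit_small: "infdist (\<theta> t (node (b @ [c]))) X \<le> infdist z0 X / 2 ^ length b" for t b c
  proof -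
    have "infdist (\<theta> t (node (b @ [c]))) X \<le> infdist (node b) X / 2"
      using step(3)[OF node_L] by (simp add: node_append)
    also have "\<dots> \<le> infdist (node b) X"
      using infdist_nonneg[of "node b" X] by simp
    finally show ?thesis
      using node_small[of b] by linarith
  qed
  define \<psi> where "\<psi> b = orbit \<theta> (node b)" for b
  have "is_tree \<theta> X (\<psi> ` E_fin) \<psi>"
    unfolding is_tree_def
  proof (intro conjI ballI)
    have "\<psi> b \<in> Orb \<theta> ({y. infdist y X \<le> d} - X)" for b
      unfolding \<psi>_def
    proof (rule orbit_in_Orb[OF CMinD(5)[OF X]])
      show "node b \<notin> X" "\<theta> t (node b) \<in> {y. infdist y X \<le> d}" for t
        using node_L[of b] invariantD[OF iL, of "node b" t] L(2) by blast+
    qed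
    then have "\<psi> ` E_fin \<subseteq> Orb \<theta> ({y. infdist y X \<le> d} - X)"
      by blast
    then show "\<exists>U. compact U \<and> nbhd X U \<and> \<psi> ` E_fin \<subseteq> Orb \<theta> (U - X)"
      using isolatingD(2)[OF iso] nbhd_collar[OF isolatingD(1)[OF iso], of X] by blast
  next
    fix b c
    have "\<psi> (b @ [c]) \<subseteq> (if c = 0 then alpha_lim \<theta> (node b) else omega_lim \<theta> (node b))"
      unfolding \<psi>_def node_append
      by (rule orbit_subset[OF _ step(2)[OF node_L]]) (simp add: invariant_alpha_lim invariant_omega_lim)
    then show "succ_digit \<theta> c (\<psi> b) (\<psi> (b @ [c]))"
      unfolding succ_digit_def \<psi>_def alpha_orb_orbit omega_orb_orbit .
    show "\<not> succ_any \<theta> (\<psi> (b @ [c])) (\<psi> b)"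
      unfolding \<psi>_def node_append
      by (rule not_succ_any_of_smaller[OF step(3)[OF node_L]]) (use pos[OF node_L] in simp)
  next
    fix v :: "nat \<Rightarrow> nat"
    have bounds: "0 \<le> excess X (closure (\<psi> (seq_prefix v n)))"
      "excess X (closure (\<psi> (seq_prefix v n))) \<le> infdist z0 X / 2 ^ n" for n
    proof -
      have "seq_prefix v n = map v [0..<n] @ [v n]"
        by (simp add: seq_prefix_def)
      then have "infdist (\<theta> t (node (seq_prefix v n))) X \<le> infdist z0 X / 2 ^ n" for t
        using orbit_small[of t "map v [0..<n]" "v n"] by simp
      then show "0 \<le> excess X (closure (\<psi> (seq_prefix v n)))"
        "excess X (closure (\<psi> (seq_prefix v n))) \<le> infdist z0 X / 2 ^ n"
        unfolding \<psi>_def by (rule excess_closure_orbit)+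
    qed
    have "(\<lambda>n. infdist z0 X / 2 ^ n) \<longlonglongrightarrow> 0"
      by (rule LIMSEQ_divide_realpow_zero) simp
    then show "(\<lambda>n. excess X (closure (\<psi> (seq_prefix v n)))) \<longlonglongrightarrow> 0"
      by (rule Lim_null_comparison[rotated]) (simp add: bounds)
  qed simp
  then show ?thesis
    by blast
qed

text \<open>No nonempty \<open>\<omega>\<close>-limit set of a point outside \<open>X\<close> lies in \<open>X\<close>. So, if there is no limit-detached set
in the collar, every compact invariant set there that is not
contained in \<open>X\<close> has an orbit outside \<open>X\<close> whose \<open>\<alpha>\<close>-limit set lies in \<open>X\<close>. Applied to the closure of
the orbit reached by a shrinking step, this improves the step so that it ends at an orbit in
\<open>B\<^sup>-(X)\<close>. The starting orbit, with index 0, comes from the limit set of \<open>w\<close> and need not lie in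
\<open>B\<^sup>-(X)\<close>.\<close>

lemma omega_shell_or_limit_detached:
  assumes X: "X \<in> CMin \<theta> UNIV" and iso: "isolating X d"
    and no_plus: "\<And>w. w \<notin> X \<Longrightarrow> omega_lim \<theta> w \<noteq> {} \<Longrightarrow> \<not> omega_lim \<theta> w \<subseteq> X"
    and w: "w \<notin> X" "\<And>s. s \<ge> 0 \<Longrightarrow> infdist (\<theta> s w) X \<le> d"
  shows "(\<exists>\<gamma>. omega_shell \<theta> X \<gamma>) \<or> (\<exists>L. limit_detached X L \<and> L \<subseteq> {y. infdist y X \<le> d})"
proof (rule disjCI)
  assume no_L: "\<not> (\<exists>L. limit_detached X L \<and> L \<subseteq> {y. infdist y X \<le> d})"
  define K where "K = {y. infdist y X \<le> d}"
  define P where "P z \<longleftrightarrow> z \<notin> X \<and> (\<forall>t. \<theta> t z \<in> K)" for z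
  have K: "compact K"
    using isolatingD(2)[OF iso] by (simp add: K_def)
  have omega_K: "omega_lim \<theta> z \<subseteq> K" "omega_lim \<theta> z \<noteq> {}" if "\<And>t. t \<ge> 0 \<Longrightarrow> \<theta> t z \<in> K" for z
    using omega_lim_subset_closed[OF compact_imp_closed[OF K], of 0 z] omega_lim_nonempty[OF K, of 0 z] that
    by blast+
  have backward: "\<exists>y\<in>L - X. alpha_lim \<theta> y \<subseteq> X"
    if L: "compact L" "invariant \<theta> L" "L \<subseteq> K" "\<not> L \<subseteq> X" for L
  proof (rule ccontr)
    assume no: "\<not> ?thesis"
    have "\<not> omega_lim \<theta> y \<subseteq> X" if "y \<in> L - X" for y
      using that no_plus limits_of_compact_invariant(2)[OF L(1,2)] by blast
    then have "limit_detached X L"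
      using L no unfolding limit_detached_def by blast
    then show False
      using no_L L(3) unfolding K_def by blast
  qed
  have step_ex: "\<exists>y. P y \<and> y \<in> omega_lim \<theta> z \<and> alpha_lim \<theta> y \<subseteq> X \<and>
      (\<forall>t. infdist (\<theta> t y) X \<le> infdist z X / 2)" if z: "P z" for z
  proof -
    have zK: "\<theta> t z \<in> K" for t
      using z by (simp add: P_def)
    have "z \<notin> X"
      using z by (simp add: P_def)
    have half: "0 < infdist z X / 2" "infdist z X / 2 \<le> d"
    proof -
      show pos: "0 < infdist z X / 2"
        using infdist_pos_not_in_closed[OF CMinD(4,3)[OF X]] \<open>z \<notin> X\<close> by simp
      have "infdist z X \<le> d"
        using zK[of 0] by (simp add: K_def flow_zero)
      then show "infdist z X / 2 \<le> d"
        using pos by linarith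
    qed
    have om: "omega_lim \<theta> z \<subseteq> {y. infdist y X \<le> d}" "omega_lim \<theta> z \<noteq> {}"
      using omega_K zK unfolding K_def by blast+
    have "\<theta> t w \<in> K" if "w \<in> omega_lim \<theta> z" for w t
      using invariantD[OF invariant_omega_lim that] om(1) unfolding K_def by blast
    then have det: "\<not> omega_lim \<theta> w \<subseteq> X" if "w \<in> omega_lim \<theta> z - X" for w
      using that no_plus omega_K(2) by blast
    obtain y where y: "y \<in> omega_lim \<theta> z - X" "\<And>t. infdist (\<theta> t y) X \<le> infdist z X / 2"
      using shrinking_omega_step[OF X iso half om _ det] no_plus[OF \<open>z \<notin> X\<close> om(2)] by metis
    define L where "L = closure (orbit \<theta> y)"
    have L_half: "L \<subseteq> {x. infdist x X \<le> infdist z X / 2}"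
      unfolding L_def by (rule limits_of_orbit_in_collar(3)[OF y(2)])
    then have LK: "L \<subseteq> K"
      using half(2) unfolding K_def by force
    have iL: "invariant \<theta> L"
      unfolding L_def by (intro invariant_closure invariant_orbit)
    have "K \<inter> L = L"
      using LK by blast
    then have "compact L"
      using compact_Int_closed[OF K, of L] by (simp add: L_def)
    moreover have "y \<in> L"
      unfolding L_def using mem_orbit closure_subset by blast
    ultimately obtain x where x: "x \<in> L - X" "alpha_lim \<theta> x \<subseteq> X"
      using backward[OF _ iL LK] y(1) by blast
    have "L \<subseteq> omega_lim \<theta> z"
      unfolding L_def using y(1) by (intro closure_minimal closed_omega_lim orbit_subset invariant_omega_lim) blast
    moreover have "\<theta> t x \<in> L" for t
      using invariantD[OF iL] x(1) by blast
    ultimately show ?thesis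
      using x LK L_half unfolding P_def by (intro exI[of _ x]) blast
  qed
  then obtain step where step: "\<And>z. P z \<Longrightarrow> P (step z)" "\<And>z. P z \<Longrightarrow> step z \<in> omega_lim \<theta> z"
    "\<And>z. P z \<Longrightarrow> alpha_lim \<theta> (step z) \<subseteq> X"
    "\<And>z t. P z \<Longrightarrow> infdist (\<theta> t (step z)) X \<le> infdist z X / 2"
    by metis
  have wK: "\<theta> t w \<in> K" if "t \<ge> 0" for t
    using w(2)[OF that] by (simp add: K_def)
  obtain z0 where z0: "z0 \<in> omega_lim \<theta> w" "z0 \<notin> X"
    using no_plus[OF w(1)] omega_K(2)[OF wK] by blast
  have P0: "P z0"
    unfolding P_def using z0 omega_K(1)[OF wK] invariantD[OF invariant_omega_lim z0(1)] by blast
  define node where "node n = (step ^^ n) z0" for n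
  have node_Suc: "node (Suc n) = step (node n)" for n
    by (simp add: node_def)
  have P_node: "P (node n)" for n
    by (induction n) (simp_all add: node_Suc step(1), simp add: node_def P0)
  have node_small: "infdist (node n) X \<le> infdist z0 X / 2 ^ n" for n
  proof (induction n)
    case (Suc n)
    have "infdist (node (Suc n)) X \<le> infdist (node n) X / 2"
      using step(4)[OF P_node, of 0 n] by (simp add: node_Suc flow_zero)
    then show ?case
      using Suc by simp
  qed (simp add: node_def)
  have orbit_small: "infdist (\<theta> t (node (Suc n))) X \<le> infdist z0 X / 2 ^ n" for t n
  proof -
    have "infdist (\<theta> t (node (Suc n))) X \<le> infdist (node n) X / 2"
      using step(4)[OF P_node] by (simp add: node_Suc)
    also have "\<dots> \<le> infdist (node n) X"
      using infdist_nonneg[of "node n" X] by simp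
    finally show ?thesis
      using node_small[of n] by linarith
  qed
  define \<gamma> where "\<gamma> n = orbit \<theta> (node n)" for n
  have "omega_shell \<theta> X \<gamma>"
    unfolding omega_shell_def
  proof (intro conjI allI impI)
    have "\<gamma> n \<in> Orb \<theta> (K - X)" for n
      unfolding \<gamma>_def using P_node[of n] by (intro orbit_in_Orb[OF CMinD(5)[OF X]]) (auto simp: P_def)
    then show "\<exists>U. compact U \<and> nbhd X U \<and> (\<forall>n\<ge>1. \<gamma> n \<in> Orb \<theta> (U - X))"
      using K nbhd_collar[OF isolatingD(1)[OF iso], of X] unfolding K_def by blast
  next
    fix n :: nat assume "1 \<le> n"
    then obtain m where m: "n = Suc m"
      by (cases n) auto
    show "\<gamma> n \<subseteq> Bminus \<theta> X"
    proof
      fix x assume "x \<in> \<gamma> n"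
      then obtain t where x: "x = \<theta> t (node n)"
        by (auto simp: \<gamma>_def orbit_def)
      have "alpha_lim \<theta> x \<subseteq> X"
        using alpha_lim_shift_subset[of t "node n"] step(3)[OF P_node[of m]] unfolding x m node_Suc by blast
      moreover have "alpha_lim \<theta> x \<noteq> {}"
      proof -
        have "\<theta> (- s) x \<in> K" for s
          using P_node[of n] unfolding P_def x by (simp flip: flow_add)
        then have "omega_lim (reverse_flow \<theta>) x \<noteq> {}"
          by (intro C0_flow.omega_lim_nonempty[OF C0_flow_reverse K, of 0]) (simp add: reverse_flow_def)
        then show ?thesis
          by (simp add: omega_lim_reverse)
      qed
      ultimately show "x \<in> Bminus \<theta> X"
        by (simp add: Bminus_def)
    qed
    show "succ_digit \<theta> 1 (\<gamma> n) (\<gamma> (Suc n))"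
      unfolding succ_digit_def \<gamma>_def omega_orb_orbit node_Suc
      using orbit_subset[OF invariant_omega_lim step(2)[OF P_node]] by simp
    have "infdist (node n) X > 0"
      using infdist_pos_not_in_closed[OF CMinD(4,3)[OF X]] P_node[of n] by (simp add: P_def)
    then show "\<not> succ_any \<theta> (\<gamma> (Suc n)) (\<gamma> n)"
      unfolding \<gamma>_def node_Suc by (intro not_succ_any_of_smaller[OF step(4)[OF P_node]]) simp
  next
    have lim: "(\<lambda>n. infdist z0 X / 2 ^ n) \<longlonglongrightarrow> 0"
      by (rule LIMSEQ_divide_realpow_zero) simp
    have bounds: "0 \<le> excess X (closure (\<gamma> (Suc n)))" "excess X (closure (\<gamma> (Suc n))) \<le> infdist z0 X / 2 ^ n" for n
      unfolding \<gamma>_def by (rule excess_closure_orbit[OF orbit_small])+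
    have "(\<lambda>n. excess X (closure (\<gamma> (Suc n)))) \<longlonglongrightarrow> 0"
      by (rule Lim_null_comparison[OF _ lim]) (simp add: bounds)
    then show "(\<lambda>n. excess X (closure (\<gamma> n))) \<longlonglongrightarrow> 0"
      by (rule LIMSEQ_imp_Suc)
  qed
  then show "\<exists>\<gamma>. omega_shell \<theta> X \<gamma>"
    by blast
qed

section \<open>Isolated minimal sets satisfy one of the six conditions\<close>

lemma one_sided_dichotomy:
  assumes lc: "locally compact (UNIV :: 'a set)"
    and X: "X \<in> CMin \<theta> UNIV" and iso: "isolating X d" and unstable: "\<not> neg_stable \<theta> X"
    and no_plus: "\<And>w. w \<notin> X \<Longrightarrow> omega_lim \<theta> w \<noteq> {} \<Longrightarrow> \<not> omega_lim \<theta> w \<subseteq> X"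
  shows "(\<exists>\<gamma>. omega_shell \<theta> X \<gamma>) \<or> (\<exists>L. limit_detached X L \<and> L \<subseteq> {y. infdist y X \<le> d})"
proof -
  obtain c w where c: "c > 0" "{y. infdist y X \<le> c} \<subseteq> set_ball X d"
    and w: "infdist w X = c" "\<forall>s\<ge>0. infdist (\<theta> s w) X \<le> c"
    by (rule entry_of_not_neg_stable[OF lc CMinD(2,3,5)[OF X] unstable open_set_ball
        subset_set_ball[OF isolatingD(1)[OF iso]]])
  have "infdist (\<theta> s w) X \<le> d" if "s \<ge> 0" for s
    using w(2) that c(2) unfolding set_ball_eq_infdist[OF CMinD(3)[OF X]] by force
  moreover have "w \<notin> X"
    using w(1) c(1) by auto
  ultimately show ?thesis
    using omega_shell_or_limit_detached[OF X iso no_plus] by blast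
qed

text \<open>If \<open>X\<close> is neither stable, nor negatively stable, nor stagnant, then no point outside \<open>X\<close> has a
nonempty \<open>\<omega>\<close>-limit set in \<open>X\<close>, or none has a nonempty \<open>\<alpha>\<close>-limit set there. The second case is the first one in
reversed time. Reversal would exchange the digits of a tree, so trees are built from limit-detached
sets only after returning to \<open>\<theta>\<close>.\<close>

lemma isolated_min_imp_M_1_6:
  assumes lc: "locally compact (UNIV :: 'a set)" and isol: "isolated_min \<theta> X"
  shows "X \<in> M_1_6 \<theta>"
proof -
  interpret rev: C0_flow "reverse_flow \<theta>"
    by (rule C0_flow_reverse)
  have X: "X \<in> CMin \<theta> UNIV"
    using isol by (simp add: isolated_min_def)
  then have X_rev: "X \<in> CMin (reverse_flow \<theta>) UNIV"
    by (simp add: CMin_reverse)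
  obtain d where iso: "isolating X d"
    by (rule isolated_min_imp_isolating[OF lc isol])
  then have iso_rev: "rev.isolating X d"
    by (simp add: isolating_reverse)
  have tree: "cond6 \<theta> X" if "limit_detached X L" "L \<subseteq> {y. infdist y X \<le> d}" for L
    unfolding cond6_def using isol limit_detached_imp_tree[OF X iso that] by blast
  consider (stable) "stable \<theta> X" | (neg_stable) "neg_stable \<theta> X" | (stagnant) "stagnant \<theta> X"
    | (no_plus) "\<not> neg_stable \<theta> X" "\<And>w. w \<notin> X \<Longrightarrow> omega_lim \<theta> w \<noteq> {} \<Longrightarrow> \<not> omega_lim \<theta> w \<subseteq> X"
    | (no_minus) "\<not> stable \<theta> X" "\<And>w. w \<notin> X \<Longrightarrow> alpha_lim \<theta> w \<noteq> {} \<Longrightarrow> \<not> alpha_lim \<theta> w \<subseteq> X"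
    unfolding stagnant_def by blast
  then have "cond1 \<theta> X \<or> cond2 \<theta> X \<or> cond3 \<theta> X \<or> cond4 \<theta> X \<or> cond5 \<theta> X \<or> cond6 \<theta> X"
  proof cases
    case stable
    then show ?thesis
      using stable_isolating_imp_attractor[OF X iso] by (simp add: cond1_def)
  next
    case neg_stable
    then show ?thesis
      using rev.stable_isolating_imp_attractor[OF X_rev iso_rev]
      by (simp add: cond2_def stable_reverse attractor_reverse)
  next
    case stagnant
    then show ?thesis
      using isol by (simp add: cond3_def)
  next
    case no_plus
    then show ?thesis
      using one_sided_dichotomy[OF lc X iso] tree isol unfolding cond5_def by blast
  next
    case no_minus
    have "(\<exists>\<gamma>. omega_shell (reverse_flow \<theta>) X \<gamma>) \<or>
      (\<exists>L. rev.limit_detached X L \<and> L \<subseteq> {y. infdist y X \<le> d})"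
      by (rule rev.one_sided_dichotomy[OF lc X_rev iso_rev])
        (use no_minus in \<open>simp_all add: neg_stable_reverse omega_lim_reverse\<close>)
    then show ?thesis
      using tree isol unfolding cond4_def alpha_shell_def limit_detached_reverse by blast
  qed
  then show ?thesis
    using X by (simp add: M_1_6_def)
qed

lemma M_1_6_eq_isolated_min:
  assumes lc: "locally compact (UNIV :: 'a set)"
  shows "M_1_6 \<theta> = {X \<in> CMin \<theta> UNIV. isolated_min \<theta> X}"
proof
  interpret rev: C0_flow "reverse_flow \<theta>"
    by (rule C0_flow_reverse)
  have "isolated_min \<theta> X" if X: "X \<in> CMin \<theta> UNIV" and "cond2 \<theta> X" for X
    using rev.attractor_imp_isolated_min[of X] that
    by (simp add: cond2_def CMin_reverse attractor_reverse isolated_min_reverse)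
  then show "M_1_6 \<theta> \<subseteq> {X \<in> CMin \<theta> UNIV. isolated_min \<theta> X}"
    using attractor_imp_isolated_min
    by (auto simp: M_1_6_def cond1_def cond3_def cond4_def cond5_def cond6_def)
  show "{X \<in> CMin \<theta> UNIV. isolated_min \<theta> X} \<subseteq> M_1_6 \<theta>"
    using isolated_min_imp_M_1_6[OF lc] by blast
qed

end

theorem theorem2:
  fixes \<theta> :: "real \<Rightarrow> 'a::metric_space \<Rightarrow> 'a"
  assumes "locally compact (UNIV :: 'a set)"
    and "connected (UNIV :: 'a set)"
    and "C0_flow \<theta>"
  shows
    "(M_1_6 \<theta> = {X \<in> CMin \<theta> UNIV. isolated_min \<theta> X} \<and>
      countable (M_1_6 \<theta>) \<and>
      openin (CMin_topology \<theta>) (M_1_6 \<theta>)) \<and>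
     (openin (CMin_topology \<theta>) (M_10 \<theta>) \<and>
      c_dense_in_itself (M_10 \<theta>) \<and>
      (M_10 \<theta> = {} \<or> M_10 \<theta> \<approx> (UNIV :: real set))) \<and>
     (M_1_6 \<theta> \<subseteq> CMin \<theta> UNIV - M_10 \<theta> \<and>
      CMin \<theta> UNIV - M_10 \<theta> \<subseteq> CMin_topology \<theta> closure_of M_1_6 \<theta>)"
proof -
  interpret C0_flow \<theta>
    by (rule assms(3))
  note lc = assms(1)
  obtain D :: "'a set" where D: "countable D" "closure D = UNIV"
    by (rule connected_locally_compact_separable[OF lc assms(2)])
  note eq = M_1_6_eq_isolated_min[OF lc]
  have "countable (M_1_6 \<theta>)"
    unfolding eq by (rule countable_subset[OF _ countable_isolated_min[OF lc D]]) blast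
  moreover have "openin (CMin_topology \<theta>) (M_1_6 \<theta>)"
    unfolding eq by (rule openin_isolated_min[OF lc])
  moreover have "M_1_6 \<theta> \<subseteq> CMin \<theta> UNIV - M_10 \<theta>"
    unfolding eq using isolated_min_not_M_10[OF lc] by blast
  moreover have "CMin \<theta> UNIV - M_10 \<theta> \<subseteq> CMin_topology \<theta> closure_of M_1_6 \<theta>"
    unfolding eq by (rule isolated_min_dense[OF lc])
  ultimately show ?thesis
    using eq openin_M_10 c_dense_M_10 M_10_eqpoll_reals[OF D] by blast
qed

end
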